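(* Let $k$ be an algebraically closed field of characteristic $p>0$ and let $q=p^e$ with $e\geq 1$. There are exactly seven projective equivalence classes of Frobenius forms over $k$ of degree $q+1$ and embedding dimension five. Specifically, these classes are represented by the following forms in $k[x_1,\dots,x_5]$ (with the indicated ranks): (1) $x_1^{q+1}+x_2^{q+1}+x_3^{q+1}+x_4^{q+1}+x_5^{q+1}$ (rank 5); (2) $x_1^{q}x_5+x_2^{q}x_4+x_3^{q+1}+x_4^{q}x_2$ (rank 4); (3) $x_1^{q}x_5+x_2^{q}x_4+x_3^{q+1}+x_4^{q}x_1$ (rank 4); (4) $x_1^{q}x_5+x_2^{q}x_4+x_3^{q}x_2+x_4^{q}x_1$ (rank 4); (5) $x_1^{q}x_5+x_2^{q}x_3+x_3^{q}x_2+x_4^{q}x_1$ (rank 4); (6) $x_1^{q}x_5+x_2^{q}x_4+x_3^{q+1}$ (rank 3); (7) $x_1^{q}x_5+x_2^{q}x_4+x_3^{q}x_2$ (rank 3). That is, every Frobenius form of degree $q+1$ and embedding dimension five is projectively equivalent to exactly one of these seven forms.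
   Context: Let $k$ be a field of characteristic $p>0$ and $q=p^e$ with $e\geq 1$. A Frobenius form of degree $q+1$ in $x_1,\dots,x_n$ over $k$ is a polynomial of the form $h=\sum_{i=1}^n x_i^{q}L_i$ with each $L_i$ a (possibly zero) linear form in $k[x_1,\dots,x_n]$. There is a unique $n\times n$ matrix $A$ over $k$ with $h=[x_1^q\ \cdots\ x_n^q]\,A\,[x_1\ \cdots\ x_n]^{\top}$; the rank of $h$ is the rank of $A$. Two Frobenius forms in $k[x_1,\dots,x_n]$ of the same degree are projectively equivalent if one is obtained from the other by an invertible $k$-linear change of the variables $x_1,\dots,x_n$ (a change of coordinates $g\in GL_n(k)$ replaces $A$ by $(g^{[q]})^{\top}Ag$, where $g^{[q]}$ has entries the $q$-th powers of those of $g$). The embedding dimension of $h$ is the smallest number of variables needed to write $h$ after a linear change of coordinates; classes of forms of embedding dimension $n$ are taken among forms in $k[x_1,\dots,x_n]$. *)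

theory Defs
  imports "HOL-Analysis.Analysis" "HOL-Library.Poly_Mapping"
begin

text \<open>
  The polynomial ring in variables indexed by \<open>'n\<close> with coefficients in \<open>'a\<close>: finitely supported
  functions on exponent vectors, with the convolution product of \<open>Poly_Mapping\<close>.
\<close>
type_synonym ('n, 'a) mpoly = "('n \<Rightarrow>\<^sub>0 nat) \<Rightarrow>\<^sub>0 'a"

definition const :: "'a :: comm_ring_1 \<Rightarrow> ('n, 'a) mpoly" where
  "const c = Poly_Mapping.single 0 c"

definition var :: "'n \<Rightarrow> ('n, 'a :: comm_ring_1) mpoly" where
  "var i = Poly_Mapping.single (Poly_Mapping.single i 1) 1"

definition vars :: "('n, 'a :: comm_ring_1) mpoly \<Rightarrow> 'n set" where
  "vars h = (\<Union>m \<in> Poly_Mapping.keys h. Poly_Mapping.keys m)"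

definition subst_vars :: 
  "('n :: finite \<Rightarrow> ('n, 'a :: comm_ring_1) mpoly) \<Rightarrow> ('n, 'a) mpoly \<Rightarrow> ('n, 'a) mpoly" where
  "subst_vars f h =
     (\<Sum>m \<in> Poly_Mapping.keys h.
        const (Poly_Mapping.lookup h m) * (\<Prod>i\<in>UNIV. f i ^ Poly_Mapping.lookup m i))"

text \<open>The substitution of \<open>g x\<close> for the column vector \<open>x\<close> of variables.\<close>
definition lin_change :: 
  "'a :: field ^ 'n ^ 'n \<Rightarrow> ('n :: finite, 'a) mpoly \<Rightarrow> ('n, 'a) mpoly" where
  "lin_change g h = subst_vars (\<lambda>i. \<Sum>j\<in>UNIV. const (g $ i $ j) * var j) h"

definition proj_equiv :: "('n :: finite, 'a :: field) mpoly \<Rightarrow> ('n, 'a) mpoly \<Rightarrow> bool" where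
  "proj_equiv h h' \<longleftrightarrow> (\<exists>g :: 'a ^ 'n ^ 'n. invertible g \<and> h' = lin_change g h)"

definition linear_form :: "('n :: finite, 'a :: field) mpoly \<Rightarrow> bool" where
  "linear_form L \<longleftrightarrow> (\<exists>c. L = (\<Sum>j\<in>UNIV. const (c j) * var j))"

text \<open>Here \<open>q\<close> is meant to be \<open>p ^ e\<close> with \<open>e \<ge> 1\<close>, where \<open>p > 0\<close> is the characteristic.\<close>
definition frobenius_form :: "nat \<Rightarrow> ('n :: finite, 'a :: field) mpoly \<Rightarrow> bool" where
  "frobenius_form q h \<longleftrightarrow>
     (\<exists>L. (\<forall>i. linear_form (L i)) \<and> h = (\<Sum>i\<in>UNIV. var i ^ q * L i))"

text \<open>
  For \<open>q \<ge> 2\<close> the monomials \<open>var i ^ q * var j\<close> are pairwise distinct, so the matrix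
  of a Frobenius form exists and is unique.
\<close>
definition frobenius_matrix :: 
  "nat \<Rightarrow> ('n :: finite, 'a :: field) mpoly \<Rightarrow> 'a ^ 'n ^ 'n" where
  "frobenius_matrix q h =
     (THE A. h = (\<Sum>i\<in>UNIV. \<Sum>j\<in>UNIV. var i ^ q * const (A $ i $ j) * var j))"

definition frobenius_rank :: "nat \<Rightarrow> ('n :: finite, 'a :: field) mpoly \<Rightarrow> nat" where
  "frobenius_rank q h = rank (frobenius_matrix q h)"

definition embedding_dim :: "('n :: finite, 'a :: field) mpoly \<Rightarrow> nat" where
  "embedding_dim h =
     (LEAST r. \<exists>g :: 'a ^ 'n ^ 'n. invertible g \<and> card (vars (lin_change g h)) = r)"

text \<open>
  The index type \<open>5\<close> has exactly the elements \<open>1, 2, 3, 4, 5\<close> (with \<open>5 = 0\<close>).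
\<close>
definition quinary_representatives :: "nat \<Rightarrow> (5, 'a :: field) mpoly list" where
  "quinary_representatives q =
     [var 1 ^ (q+1) + var 2 ^ (q+1) + var 3 ^ (q+1) + var 4 ^ (q+1) + var 5 ^ (q+1),
      var 1 ^ q * var 5 + var 2 ^ q * var 4 + var 3 ^ (q+1) + var 4 ^ q * var 2,
      var 1 ^ q * var 5 + var 2 ^ q * var 4 + var 3 ^ (q+1) + var 4 ^ q * var 1,
      var 1 ^ q * var 5 + var 2 ^ q * var 4 + var 3 ^ q * var 2 + var 4 ^ q * var 1,
      var 1 ^ q * var 5 + var 2 ^ q * var 3 + var 3 ^ q * var 2 + var 4 ^ q * var 1,
      var 1 ^ q * var 5 + var 2 ^ q * var 4 + var 3 ^ (q+1),
      var 1 ^ q * var 5 + var 2 ^ q * var 4 + var 3 ^ q * var 2]"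

definition quinary_frobenius_forms :: "nat \<Rightarrow> (5, 'a :: field) mpoly set" where
  "quinary_frobenius_forms q = {h. frobenius_form q h \<and> embedding_dim h = 5}"

definition quinary_equiv :: "nat \<Rightarrow> ((5, 'a :: field) mpoly \<times> (5, 'a) mpoly) set" where
  "quinary_equiv q =
     {(h, h'). h \<in> quinary_frobenius_forms q \<and> h' \<in> quinary_frobenius_forms q \<and> proj_equiv h h'}"

end

theory Submission
  imports Defs
begin

text \<open>
A Frobenius form with matrix \<open>A\<close> is governed by \<open>\<beta> x y = (\<Sum>i j. x_i^q * A_ij * y_j)\<close>: it is additive
in both arguments, linear in the second one and \<open>q\<close>-semilinear in the first, and a linear change of
variables of the polynomial is a change of basis for \<open>\<beta>\<close> (\<open>lin_change_frob_poly\<close>, \<open>bform_congr\<close>).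
A variable can be eliminated exactly when the right radical (the \<open>y\<close> with \<open>\<beta> _ y = 0\<close>) and
the left radical (the \<open>x\<close> with \<open>\<beta> x _ = 0\<close>) meet (\<open>embedding_dim_full_iff\<close>). So the task is to
classify the forms \<open>\<beta>\<close> on a five-dimensional space whose radicals \<open>R\<close> and \<open>L\<close> meet only in \<open>0\<close>.

Such a form is an orthogonal sum of a nondegenerate form, written \<open>F_m\<close> in dimension \<open>m\<close>, and of
chains \<open>J_k\<close> with \<open>k \<ge> 2\<close>: a basis \<open>v_1, ..., v_k\<close> with \<open>\<beta> v_i v_{i+1} = 1\<close> and all other values \<open>0\<close>. The
seven classes are the seven ways to write \<open>5\<close> as \<open>m\<close> plus a sum of numbers \<open>k \<ge> 2\<close>.

Nondegenerate part: there is a unique \<open>\<phi>\<close> with \<open>\<beta> y (\<phi> x) = (\<beta> x y)^q\<close>, and it is \<open>q^2\<close>-semilinear and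
injective. By an elementary case of Lang's theorem its fixed vectors span the space
(\<open>span_fixed_vectors\<close>), and on them \<open>\<beta>\<close> is Hermitian over the field with \<open>q^2\<close> elements. A Hermitian
form that is not zero has a vector of length one, which splits off; hence there is an orthonormal basis
(\<open>orthonormal_basis\<close>), and \<open>F_m\<close> is unique.

Degenerate part: \<open>R\<close> and \<open>L\<close> have the same dimension \<open>d \<le> 2\<close>. If \<open>\<beta> r l \<noteq> 0\<close> for some \<open>r \<in> R\<close> and \<open>l \<in> L\<close>,
then these two vectors form a chain \<open>J_2\<close> that splits off (\<open>split_path2\<close>). This always happens for
\<open>d = 2\<close> and leaves a form of corank one in dimension three. If \<open>R\<close> and \<open>L\<close> are
orthogonal lines spanned by \<open>r\<close> and \<open>l\<close>, compare the hyperplanes \<open>\<beta> r _ = 0\<close> and \<open>\<beta> _ l = 0\<close>. If they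
coincide, a chain \<open>J_3\<close> splits off (\<open>split_path3\<close>). If not, their intersection is spanned by \<open>r\<close>, \<open>l\<close> and a
third vector \<open>u\<close>, and the form is \<open>J_4 + F_1\<close> or \<open>J_5\<close> according to whether \<open>\<beta> u u\<close> is nonzero
or zero (\<open>corank_one_perps_differ\<close>).

Conversely each of these distinctions is phrased in terms of \<open>\<beta>\<close> alone. They combine into a number
\<open>class_index \<beta>\<close> that is invariant under change of basis and takes seven different values on the seven
representatives, so no form is equivalent to two of them.
\<close>

section \<open>Sesquilinear forms over a field automorphism\<close>

lemma hyperplane_section:
  fixes f :: "'a::field^'n \<Rightarrow> 'a"
  assumes X: "vec.subspace X"
    and add: "\<And>x y. f (x + y) = f x + f y" and scale: "\<And>c x. f (c *s x) = c * f x"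
  shows "vec.subspace {x \<in> X. f x = 0}"
    and "s \<in> X \<Longrightarrow> f s \<noteq> 0 \<Longrightarrow> vec.span (insert s {x \<in> X. f x = 0}) = X"
    and "s \<in> X \<Longrightarrow> f s \<noteq> 0 \<Longrightarrow> vec.dim X = Suc (vec.dim {x \<in> X. f x = 0})"
proof -
  have f0: "f 0 = 0" using add[of 0 0] by (metis add.right_neutral add_left_cancel)
  show sub: "vec.subspace {x \<in> X. f x = 0}"
    using X by (auto simp: vec.subspace_def add scale f0)
  assume s: "s \<in> X" "f s \<noteq> 0"
  show sp: "vec.span (insert s {x \<in> X. f x = 0}) = X"
  proof (rule vec.span_subspace)
    show "insert s {x \<in> X. f x = 0} \<subseteq> X" using s by auto
    show "vec.subspace X" by fact
    show "X \<subseteq> vec.span (insert s {x \<in> X. f x = 0})"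
    proof
      fix x assume x: "x \<in> X"
      define c where "c = f x / f s"
      have "f (x - c *s s) = 0"
        using add[of "x - c *s s" "c *s s"] s(2) by (simp add: scale c_def)
      then have "x - c *s s \<in> {x \<in> X. f x = 0}"
        using x s X by (auto intro: vec.subspace_diff vec.subspace_scale)
      then show "x \<in> vec.span (insert s {x \<in> X. f x = 0})"
        unfolding vec.span_breakdown_eq by (blast intro: vec.span_base)
    qed
  qed
  have "s \<notin> vec.span {x \<in> X. f x = 0}"
    using s sub by (simp add: vec.span_eq_iff[THEN iffD2])
  then have "vec.dim (insert s {x \<in> X. f x = 0}) = Suc (vec.dim {x \<in> X. f x = 0})"
    by (simp add: vec.dim_insert)
  then show "vec.dim X = Suc (vec.dim {x \<in> X. f x = 0})"
    using vec.dim_span[of "insert s {x \<in> X. f x = 0}"] sp by simp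
qed

text \<open>
Allowing an arbitrary automorphism \<open>\<sigma>\<close>, rather than only the \<open>q\<close>-th power map, makes the notion
self-dual: swapping the arguments and applying the inverse of \<open>\<sigma>\<close> gives a form of the same kind. Every
statement about right radicals then yields its mirror image about left radicals.
\<close>

locale sesquilinear =
  fixes \<sigma> :: "'a::field \<Rightarrow> 'a" and \<beta> :: "'a^'n \<Rightarrow> 'a^'n \<Rightarrow> 'a"
  assumes \<sigma>_add: "\<sigma> (a + b) = \<sigma> a + \<sigma> b"
    and \<sigma>_mult: "\<sigma> (a * b) = \<sigma> a * \<sigma> b"
    and \<sigma>_bij: "bij \<sigma>"
    and add_left: "\<beta> (x + y) z = \<beta> x z + \<beta> y z"
    and add_right: "\<beta> x (y + z) = \<beta> x y + \<beta> x z"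
    and scale_left: "\<beta> (c *s x) y = \<sigma> c * \<beta> x y"
    and scale_right: "\<beta> x (c *s y) = c * \<beta> x y"
begin

lemma \<sigma>_0 [simp]: "\<sigma> 0 = 0" using \<sigma>_add[of 0 0] by (metis add.right_neutral add_left_cancel)

lemma \<sigma>_eq_0_iff [simp]: "\<sigma> a = 0 \<longleftrightarrow> a = 0"
  using \<sigma>_bij \<sigma>_0 by (metis bij_pointE)

lemma \<sigma>_surj: "\<exists>a. \<sigma> a = b" using \<sigma>_bij by (metis bij_pointE)

lemma zero_left [simp]: "\<beta> 0 y = 0" using add_left[of 0 0 y] by (metis add.right_neutral add_left_cancel)
lemma zero_right [simp]: "\<beta> x 0 = 0" using add_right[of x 0 0] by (metis add.right_neutral add_left_cancel)
lemma minus_left: "\<beta> (- x) y = - \<beta> x y" using add_left[of x "- x" y] by (simp add: eq_neg_iff_add_eq_0 add.commute)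
lemma minus_right: "\<beta> x (- y) = - \<beta> x y" using add_right[of x y "- y"] by (simp add: eq_neg_iff_add_eq_0 add.commute)
lemma diff_left: "\<beta> (x - y) z = \<beta> x z - \<beta> y z" using add_left[of x "- y" z] by (simp add: minus_left)
lemma diff_right: "\<beta> x (y - z) = \<beta> x y - \<beta> x z" using add_right[of x y "- z"] by (simp add: minus_right)
lemma sum_right: "\<beta> x (\<Sum>i\<in>I. f i) = (\<Sum>i\<in>I. \<beta> x (f i))"
  by (induction I rule: infinite_finite_induct) (auto simp: add_right)

lemmas expand = add_left add_right scale_left scale_right diff_left diff_right

lemma dual: "sesquilinear (inv \<sigma>) (\<lambda>x y. inv \<sigma> (\<beta> y x))"
proof -
  have inj: "inj \<sigma>" and surj: "surj \<sigma>" using \<sigma>_bij by (auto simp: bij_def)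
  have eqI: "inv \<sigma> a = b" if "a = \<sigma> b" for a b using that inj by simp
  have s: "\<sigma> (inv \<sigma> a) = a" for a using surj by (rule surj_f_inv_f)
  show ?thesis
    by unfold_locales
       (use \<sigma>_bij in \<open>auto simp: bij_imp_bij_inv \<sigma>_add \<sigma>_mult s expand intro!: eqI\<close>)
qed

lemma inv_\<sigma>_eq_0_iff [simp]: "inv \<sigma> a = 0 \<longleftrightarrow> a = 0"
  using sesquilinear.\<sigma>_eq_0_iff[OF dual] .

definition right_radical where "right_radical X = {y \<in> X. \<forall>x\<in>X. \<beta> x y = 0}"
definition left_radical where "left_radical X = {x \<in> X. \<forall>y\<in>X. \<beta> x y = 0}"

lemma dual_right_radical:
  "sesquilinear.right_radical (\<lambda>x y. inv \<sigma> (\<beta> y x)) X = left_radical X"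
  "sesquilinear.left_radical (\<lambda>x y. inv \<sigma> (\<beta> y x)) X = right_radical X"
  by (auto simp: sesquilinear.right_radical_def[OF dual] sesquilinear.left_radical_def[OF dual]
      left_radical_def right_radical_def)

lemma subspace_right_radical: "vec.subspace X \<Longrightarrow> vec.subspace (right_radical X)"
  by (auto simp: vec.subspace_def right_radical_def expand)

lemma subspace_left_radical: "vec.subspace X \<Longrightarrow> vec.subspace (left_radical X)"
  by (auto simp: vec.subspace_def left_radical_def expand)

lemma right_perp:
  assumes "vec.subspace X"
  shows "vec.subspace {x \<in> X. \<beta> a x = 0}"
    and "s \<in> X \<Longrightarrow> \<beta> a s \<noteq> 0 \<Longrightarrow> vec.span (insert s {x \<in> X. \<beta> a x = 0}) = X"
    and "s \<in> X \<Longrightarrow> \<beta> a s \<noteq> 0 \<Longrightarrow> vec.dim X = Suc (vec.dim {x \<in> X. \<beta> a x = 0})"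
  using hyperplane_section[OF assms, of "\<beta> a"] by (auto simp: expand)

lemma left_perp:
  assumes "vec.subspace X"
  shows "vec.subspace {x \<in> X. \<beta> x a = 0}"
    and "s \<in> X \<Longrightarrow> \<beta> s a \<noteq> 0 \<Longrightarrow> vec.span (insert s {x \<in> X. \<beta> x a = 0}) = X"
    and "s \<in> X \<Longrightarrow> \<beta> s a \<noteq> 0 \<Longrightarrow> vec.dim X = Suc (vec.dim {x \<in> X. \<beta> x a = 0})"
  using sesquilinear.right_perp(1)[OF dual assms, of a]
    sesquilinear.right_perp(2,3)[OF dual assms, of s a] by simp_all

lemma dim_right_perp_le:
  assumes "vec.subspace X"
  shows "vec.dim X \<le> Suc (vec.dim {x \<in> X. \<beta> a x = 0})"
proof (cases "\<exists>s\<in>X. \<beta> a s \<noteq> 0")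
  case True then show ?thesis using right_perp(3)[OF assms] by auto
next
  case False then have "{x \<in> X. \<beta> a x = 0} = X" by auto
  then show ?thesis by simp
qed

lemma dim_right_perp_set:
  assumes X: "vec.subspace X" and "finite S"
  shows "vec.subspace {x \<in> X. \<forall>a\<in>S. \<beta> a x = 0} \<and>
    vec.dim X \<le> vec.dim {x \<in> X. \<forall>a\<in>S. \<beta> a x = 0} + card S"
  using \<open>finite S\<close>
proof induction
  case empty then show ?case using X by simp
next
  case (insert c S)
  let ?Y = "{x \<in> X. \<forall>a\<in>S. \<beta> a x = 0}"
  have eq: "{x \<in> X. \<forall>a\<in>insert c S. \<beta> a x = 0} = {x \<in> ?Y. \<beta> c x = 0}" by auto
  show ?case unfolding eq
    using right_perp(1)[of ?Y c] dim_right_perp_le[of ?Y c] insert by auto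
qed

lemma left_zero_on_span:
  assumes "\<And>b. b \<in> B \<Longrightarrow> \<beta> b y = 0" and "x \<in> vec.span B"
  shows "\<beta> x y = 0"
  using assms(2) by (induction rule: vec.span_induct_alt) (auto simp: assms(1) expand)

lemma right_zero_on_span:
  assumes "\<And>b. b \<in> B \<Longrightarrow> \<beta> x b = 0" and "y \<in> vec.span B"
  shows "\<beta> x y = 0"
  using assms(2) by (induction rule: vec.span_induct_alt) (auto simp: assms(1) expand)

text \<open>
Extend a basis \<open>B\<close> of the left radical to a basis \<open>C\<close> of \<open>X\<close>. Since elements of \<open>B\<close> impose no condition,
the right radical is already cut out by the \<open>dim X - dim L\<close> functionals \<open>\<beta> c\<close> with \<open>c \<in> C - B\<close>, so
its dimension is at least \<open>dim L\<close>. Duality turns this into an equality.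
\<close>

lemma dim_left_radical_le:
  assumes X: "vec.subspace X"
  shows "vec.dim (left_radical X) \<le> vec.dim (right_radical X)"
proof -
  let ?L = "left_radical X"
  obtain B where B: "B \<subseteq> ?L" "vec.independent B" "?L \<subseteq> vec.span B"
    using vec.maximal_independent_subset by blast
  have "B \<subseteq> X" using B by (auto simp: left_radical_def)
  then obtain C where C: "B \<subseteq> C" "C \<subseteq> X" "vec.independent C" "X \<subseteq> vec.span C"
    using vec.maximal_independent_subset_extend[OF _ B(2)] by metis
  have fin: "finite C" using C vec.finiteI_independent by blast
  have dims: "card B = vec.dim ?L" "card C = vec.dim X"
    using B C by (simp_all add: vec.basis_card_eq_dim)
  let ?Y = "{x \<in> X. \<forall>a\<in>C - B. \<beta> a x = 0}"
  have "?Y \<subseteq> right_radical X"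
  proof
    fix y assume y: "y \<in> ?Y"
    have "\<beta> b y = 0" if "b \<in> C" for b
      using that y B(1) by (cases "b \<in> B") (auto simp: left_radical_def)
    then have "\<beta> x y = 0" if "x \<in> X" for x
      using left_zero_on_span that C(4) by blast
    then show "y \<in> right_radical X" using y by (auto simp: right_radical_def)
  qed
  then have "vec.dim ?Y \<le> vec.dim (right_radical X)" by (rule vec.dim_subset)
  moreover have "vec.dim X \<le> vec.dim ?Y + card (C - B)"
    using dim_right_perp_set[OF X, of "C - B"] fin by auto
  moreover have "card (C - B) = vec.dim X - vec.dim ?L"
    using dims C(1) fin by (metis card_Diff_subset finite_subset)
  moreover have "vec.dim ?L \<le> vec.dim X"
    by (rule vec.dim_subset) (auto simp: left_radical_def)
  ultimately show ?thesis by linarith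
qed

lemma dim_radicals_eq:
  assumes "vec.subspace X"
  shows "vec.dim (left_radical X) = vec.dim (right_radical X)"
  using dim_left_radical_le[OF assms] sesquilinear.dim_left_radical_le[OF dual assms]
  by (simp add: dual_right_radical)

lemma left_radical_trivial:
  assumes "vec.subspace X" and "right_radical X = {0}"
  shows "left_radical X = {0}"
proof -
  have "vec.dim (left_radical X) = 0" using dim_radicals_eq[OF assms(1)] assms(2) by simp
  then have "left_radical X \<subseteq> {0}" by (simp add: vec.dim_eq_0)
  then show ?thesis using vec.subspace_0[OF subspace_left_radical[OF assms(1)]] by blast
qed

text \<open>
A nondegenerate form identifies the space with its semilinear dual: each of the conditions
\<open>\<beta> a z = 0\<close> with \<open>a\<close> in a basis lowers the dimension by at most one, so dropping one of them leaves a
nonzero \<open>z\<close>, and nondegeneracy forbids the dropped value to vanish. This is a dual basis.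
\<close>

lemma represent_functional:
  assumes X: "vec.subspace X" and R: "right_radical X = {0}"
    and f_add: "\<And>x y. f (x + y) = f x + f y" and f_scale: "\<And>c x. f (c *s x) = \<sigma> c * f x"
  shows "\<exists>z\<in>X. \<forall>y\<in>X. \<beta> y z = f y"
proof -
  obtain B where B: "B \<subseteq> X" "vec.independent B" "X \<subseteq> vec.span B" "card B = vec.dim X"
    using vec.basis_exists by blast
  have fin: "finite B" using B vec.finiteI_independent by blast
  have "\<exists>z\<in>X. \<beta> b z = 1 \<and> (\<forall>a\<in>B - {b}. \<beta> a z = 0)" if b: "b \<in> B" for b
  proof -
    let ?Y = "{x \<in> X. \<forall>a\<in>B - {b}. \<beta> a x = 0}"
    have "vec.dim X \<le> vec.dim ?Y + card (B - {b})"
      using dim_right_perp_set[OF X, of "B - {b}"] fin by auto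
    moreover have "card (B - {b}) < card B" using b fin by (meson card_Diff1_less)
    ultimately have "vec.dim ?Y \<noteq> 0" using B(4) by linarith
    then have "\<not> ?Y \<subseteq> {0}" by simp
    then obtain z where z: "z \<in> ?Y" "z \<noteq> 0" by auto
    have "\<beta> b z \<noteq> 0"
    proof
      assume "\<beta> b z = 0"
      then have "\<beta> x z = 0" if "x \<in> X" for x
        using left_zero_on_span[of B z x] z that B(3) by blast
      then show False using z R by (auto simp: right_radical_def)
    qed
    then show ?thesis
      using z X by (intro bexI[of _ "inverse (\<beta> b z) *s z"]) (auto simp: expand vec.subspace_scale)
  qed
  then obtain Z where Z: "\<And>b. b \<in> B \<Longrightarrow> Z b \<in> X" "\<And>b. b \<in> B \<Longrightarrow> \<beta> b (Z b) = 1"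
    "\<And>a b. b \<in> B \<Longrightarrow> a \<in> B \<Longrightarrow> a \<noteq> b \<Longrightarrow> \<beta> a (Z b) = 0"
    by (metis DiffI singletonD)
  define z where "z = (\<Sum>b\<in>B. f b *s Z b)"
  have zB: "\<beta> a z = f a" if a: "a \<in> B" for a
  proof -
    have "\<beta> a z = (\<Sum>b\<in>B. f b * \<beta> a (Z b))" by (simp add: z_def sum_right expand)
    also have "\<dots> = (\<Sum>b\<in>B. if a = b then f b else 0)"
      using a Z by (intro sum.cong) auto
    finally show ?thesis using a fin by simp
  qed
  have f0: "f 0 = 0" using f_add[of 0 0] by (metis add.right_neutral add_left_cancel)
  have "\<beta> y z = f y" if "y \<in> vec.span B" for y
    using that by (induction rule: vec.span_induct_alt) (auto simp: f0 f_add f_scale expand zB)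
  moreover have "z \<in> X"
    unfolding z_def using Z(1) X by (intro vec.subspace_sum vec.subspace_scale) auto
  ultimately show ?thesis using B(3) by blast
qed

end

section \<open>Fixed vectors of Frobenius-semilinear maps\<close>

text \<open>
With \<open>a = 0\<close>, \<open>a = -1\<close> and \<open>a = 1\<close> this supplies the roots, Artin-Schreier roots and trace-one elements used
below.
\<close>

lemma root_additive_polynomial:
  fixes a c :: "'a::alg_closed_field"
  assumes "Q > 1"
  shows "\<exists>d. d ^ Q + a * d = c"
proof -
  let ?p = "monom 1 Q + [:- c, a:]"
  have "degree ?p = Q"
    using assms by (subst degree_add_eq_left) (auto simp: degree_monom_eq)
  then obtain d where "poly ?p d = 0"
    using alg_closed_imp_poly_has_root[of ?p] assms by auto
  then have "d ^ Q + a * d = c" by (simp add: poly_monom algebra_simps)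
  then show ?thesis ..
qed

text \<open>
The coefficient recursion for a fixed vector (see \<open>span_fixed_vectors\<close>), as a polynomial in the unknown \<open>t\<close>.
\<close>

fun twisted_horner :: "nat \<Rightarrow> (nat \<Rightarrow> 'a::comm_semiring_1) \<Rightarrow> nat \<Rightarrow> 'a poly" where
  "twisted_horner Q a 0 = [:0, a 0:]"
| "twisted_horner Q a (Suc i) = twisted_horner Q a i ^ Q + [:0, a (Suc i):]"

lemma twisted_horner_at_0: "Q > 0 \<Longrightarrow> poly (twisted_horner Q a i) 0 = 0"
  by (induction i) (auto simp: power_0_left)

text \<open>
The power \<open>P^Q\<close> of a polynomial without constant term only involves exponents at least \<open>Q > 1\<close>, so it cannot
cancel the linear term that is added to it.
\<close>

lemma twisted_horner_eq_0D:
  fixes a :: "nat \<Rightarrow> 'a::field"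
  assumes "Q > 1"
  shows "twisted_horner Q a i = 0 \<Longrightarrow> j \<le> i \<Longrightarrow> a j = 0"
proof (induction i arbitrary: j)
  case 0 then show ?case by simp
next
  case (Suc i)
  let ?P = "twisted_horner Q a i"
  have "[:0, 1:] dvd ?P"
    using twisted_horner_at_0[of Q a i] assms by (simp add: poly_eq_0_iff_dvd)
  then have "[:0, 1:] ^ Q dvd ?P ^ Q" by (rule dvd_power_same)
  then have "monom 1 Q dvd ?P ^ Q" by (simp add: monom_altdef)
  then have "coeff (?P ^ Q) 1 = 0"
    using assms by (auto simp: monom_1_dvd_iff')
  moreover have "coeff (?P ^ Q + [:0, a (Suc i):]) 1 = 0"
    using Suc.prems(1) by simp
  ultimately have a: "a (Suc i) = 0" by simp
  then have "?P = 0" using Suc.prems(1) assms by simp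
  then show ?case using Suc a by (metis le_Suc_eq)
qed

text \<open>
The recursion expresses \<open>b m\<close> as a polynomial \<open>P(t) = t S(t)\<close>. The remaining equation \<open>P(t)^Q = t\<close> has, besides
\<open>t = 0\<close>, the roots of \<open>t^(Q-1) S(t)^Q - 1\<close>, which is not constant because \<open>S \<noteq> 0\<close>, and which does
not vanish at \<open>0\<close>.
\<close>

lemma fixed_vector_recursion:
  fixes a :: "nat \<Rightarrow> 'a::alg_closed_field"
  assumes Q: "Q > 1" and a: "j \<le> m" "a j \<noteq> 0"
  shows "\<exists>t b. t \<noteq> 0 \<and> b 0 = a 0 * t \<and> (\<forall>i<m. b (Suc i) = b i ^ Q + a (Suc i) * t) \<and> b m ^ Q = t"
proof -
  let ?P = "twisted_horner Q a"
  have "?P m \<noteq> 0" using twisted_horner_eq_0D[OF Q, of a m j] a by blast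
  moreover have "[:0, 1:] dvd ?P m"
    using twisted_horner_at_0[of Q a m] Q by (simp add: poly_eq_0_iff_dvd)
  ultimately obtain S where S: "?P m = [:0, 1:] * S" "S \<noteq> 0" by (auto elim: dvdE)
  let ?G = "monom 1 (Q - 1) * S ^ Q + [:- 1:]"
  have dS: "degree (monom 1 (Q - 1) * S ^ Q) \<ge> Q - 1"
    using S(2) by (simp add: degree_mult_eq degree_monom_eq monom_eq_0_iff)
  then have "degree ?G \<ge> Q - 1"
    using Q by (subst degree_add_eq_left) auto
  then have "degree ?G > 0" using Q by linarith
  then obtain t where t: "poly ?G t = 0"
    using alg_closed_imp_poly_has_root by blast
  then have t1: "t ^ (Q - 1) * poly S t ^ Q = 1" by (simp add: poly_monom)
  have "t \<noteq> 0" using t1 Q by (auto simp: power_0_left split: if_splits)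
  have "poly (?P m) t ^ Q = t ^ Q * poly S t ^ Q"
    by (simp add: S(1) power_mult_distrib)
  also have "\<dots> = t * (t ^ (Q - 1) * poly S t ^ Q)"
    using Q by (simp add: power_eq_if[of t Q])
  finally have "poly (?P m) t ^ Q = t" using t1 by simp
  then show ?thesis
    using \<open>t \<noteq> 0\<close> by (intro exI[of _ t] exI[of _ "\<lambda>i. poly (?P i) t"]) (auto simp: algebra_simps)
qed

lemma in_span_Un_family:
  assumes S: "vec.subspace S" and "y \<in> vec.span (S \<union> x ` {..<k::nat})"
  shows "\<exists>s\<in>S. \<exists>a. y = s + (\<Sum>i<k. a i *s x i)"
  using assms(2)
proof (induction k arbitrary: y)
  case 0 then show ?case using S by (auto simp: vec.span_eq_iff[THEN iffD2])
next
  case (Suc k)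
  have "S \<union> x ` {..<Suc k} = insert (x k) (S \<union> x ` {..<k})" by (auto simp: less_Suc_eq)
  then obtain c where "y - c *s x k \<in> vec.span (S \<union> x ` {..<k})"
    using Suc.prems by (auto simp: vec.span_breakdown_eq)
  from Suc.IH[OF this] obtain s a where s: "s \<in> S" "y - c *s x k = s + (\<Sum>i<k. a i *s x i)"
    by blast
  have "y = s + (\<Sum>i<Suc k. (a(k := c)) i *s x i)"
    using s(2) by (simp add: algebra_simps)
  then show ?case using s(1) by blast
qed

lemma first_dependence:
  fixes x :: "nat \<Rightarrow> 'a::field^'n"
  shows "\<exists>m. x m \<in> vec.span (S \<union> x ` {..<m}) \<and> (\<forall>i<m. x i \<notin> vec.span (S \<union> x ` {..<i}))"
proof -
  have "\<exists>m. x m \<in> vec.span (S \<union> x ` {..<m})"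
  proof (rule ccontr)
    assume a: "\<nexists>m. x m \<in> vec.span (S \<union> x ` {..<m})"
    have "m \<le> vec.dim (S \<union> x ` {..<m})" for m
    proof (induction m)
      case 0 show ?case by simp
    next
      case (Suc m)
      have "S \<union> x ` {..<Suc m} = insert (x m) (S \<union> x ` {..<m})" by (auto simp: less_Suc_eq)
      then show ?case using a Suc by (simp add: vec.dim_insert)
    qed
    from this[of "Suc CARD('n)"] show False
      using vec.dim_subset_UNIV[of "S \<union> x ` {..<Suc CARD('n)}"]
      by (simp add: vec.dimension_def card_cart_basis)
  qed
  then show ?thesis using exists_least_iff[of "\<lambda>m. x m \<in> vec.span (S \<union> x ` {..<m})"] by blast
qed

text \<open>
Let \<open>S\<close> be the span of the fixed vectors and suppose \<open>x \<notin> S\<close>. Take the first iterate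
\<open>\<phi>^m x = s + (\<Sum>i<m. a_i \<phi>^i x)\<close> that depends on the previous ones modulo \<open>S\<close>. The equation \<open>\<phi> v = v\<close> modulo \<open>S\<close> for
\<open>v = (\<Sum>i<m. b_i \<phi>^i x)\<close> becomes the recursion of \<open>fixed_vector_recursion\<close>; injectivity of \<open>\<phi>\<close> guarantees that
some \<open>a_i\<close> is nonzero. On \<open>S\<close> the map \<open>\<phi> - id\<close> is onto because \<open>d^Q - d = c\<close> is solvable, so \<open>v\<close>
can be corrected by an element of \<open>S\<close> to a fixed vector, which contradicts \<open>v \<notin> S\<close>.
\<close>

lemma span_fixed_vectors:
  fixes \<phi> :: "'a::alg_closed_field^'n \<Rightarrow> 'a^'n"
  assumes Q: "Q > 1" and X: "vec.subspace X" and \<phi>X: "\<And>x. x \<in> X \<Longrightarrow> \<phi> x \<in> X"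
    and \<phi>_add: "\<And>x y. x \<in> X \<Longrightarrow> y \<in> X \<Longrightarrow> \<phi> (x + y) = \<phi> x + \<phi> y"
    and \<phi>_scale: "\<And>c x. x \<in> X \<Longrightarrow> \<phi> (c *s x) = c ^ Q *s \<phi> x"
    and \<phi>_inj: "\<And>x. x \<in> X \<Longrightarrow> \<phi> x = 0 \<Longrightarrow> x = 0"
  shows "X \<subseteq> vec.span {v \<in> X. \<phi> v = v}"
proof (rule ccontr)
  define S where "S = vec.span {v \<in> X. \<phi> v = v}"
  have S: "vec.subspace S" by (simp add: S_def)
  have SX: "S \<subseteq> X" unfolding S_def using X by (intro vec.span_minimal) auto
  have \<phi>0: "\<phi> 0 = 0" using \<phi>_scale[of 0 0] X Q by (simp add: vec.subspace_0 power_0_left)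
  have \<phi>_diff: "\<phi> (x - y) = \<phi> x - \<phi> y" if "x \<in> X" "y \<in> X" for x y
    using \<phi>_add[of "x - y" y] that X by (simp add: vec.subspace_diff)
  have \<phi>_sum: "\<phi> (\<Sum>i\<in>I. f i) = (\<Sum>i\<in>I. \<phi> (f i)) \<and> (\<Sum>i\<in>I. f i) \<in> X" if "\<And>i. i \<in> I \<Longrightarrow> f i \<in> X" for I :: "nat set" and f
    using that
  proof (induction I rule: infinite_finite_induct)
    case (insert i I)
    then show ?case using X by (simp add: \<phi>_add vec.subspace_add)
  qed (use X \<phi>0 in \<open>auto simp: vec.subspace_0\<close>)
  have onto: "\<exists>d\<in>S. \<phi> d = s" if "s \<in> S" for s
    using that unfolding S_def
  proof (induction rule: vec.span_induct_alt)
    case base then show ?case using \<phi>0 vec.span_zero by blast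
  next
    case (step c x y)
    then obtain d where d: "d \<in> S" "\<phi> d = y" unfolding S_def by blast
    obtain e where e: "e ^ Q = c" using root_additive_polynomial[OF Q, of 0 c] by auto
    have x: "e *s x \<in> S" "e *s x \<in> X" using step(1) S X by (auto simp: S_def vec.span_base vec.span_scale vec.subspace_scale)
    have "\<phi> (e *s x + d) = c *s x + y"
      using step(1) d x SX e by (auto simp: \<phi>_add \<phi>_scale)
    then show ?case using x(1) d(1) S unfolding S_def[symmetric] by (blast intro: vec.subspace_add)
  qed
  have onto1: "\<exists>d\<in>S. \<phi> d - d = s" if "s \<in> S" for s
    using that unfolding S_def
  proof (induction rule: vec.span_induct_alt)
    case base then show ?case using \<phi>0 vec.span_zero by force
  next
    case (step c x y)
    then obtain d where d: "d \<in> S" "\<phi> d - d = y" unfolding S_def by blast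
    obtain e where e: "e ^ Q - e = c" using root_additive_polynomial[OF Q, of "- 1" c] by auto
    have x: "e *s x \<in> S" "e *s x \<in> X" using step(1) S X by (auto simp: S_def vec.span_base vec.span_scale vec.subspace_scale)
    have "\<phi> (e *s x + d) = e ^ Q *s x + \<phi> d"
      using step(1) d x SX by (auto simp: \<phi>_add \<phi>_scale)
    then have "\<phi> (e *s x + d) - (e *s x + d) = c *s x + y"
      using d(2) unfolding e[symmetric] by (simp add: algebra_simps vec.scale_left_diff_distrib)
    then show ?case using x(1) d(1) S unfolding S_def[symmetric] by (blast intro: vec.subspace_add)
  qed
  assume "\<not> X \<subseteq> vec.span {v \<in> X. \<phi> v = v}"
  then obtain x0 where x0: "x0 \<in> X" "x0 \<notin> S" unfolding S_def by blast
  define x where "x i = (\<phi> ^^ i) x0" for i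
  have xX: "x i \<in> X" for i by (induction i) (auto simp: x_def x0 \<phi>X)
  have x_Suc: "x (Suc i) = \<phi> (x i)" for i by (simp add: x_def)
  obtain m where m: "x m \<in> vec.span (S \<union> x ` {..<m})"
    and least: "\<And>i. i < m \<Longrightarrow> x i \<notin> vec.span (S \<union> x ` {..<i})"
    using first_dependence[of x S] by blast
  have "m \<noteq> 0"
  proof
    assume "m = 0"
    then have "x 0 \<in> S" using m S by (simp add: vec.span_eq_iff[THEN iffD2])
    then show False using x0(2) by (simp add: x_def)
  qed
  then obtain k where k: "m = Suc k" by (cases m) auto
  obtain s a where s: "s \<in> S" and a: "x (Suc k) = s + (\<Sum>i<Suc k. a i *s x i)"
    using in_span_Un_family[OF S m] unfolding k by blast
  have xk: "x k \<notin> vec.span (S \<union> x ` {..<k})" using least[of k] k by simp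
  have "\<exists>j\<le>k. a j \<noteq> 0"
  proof (rule ccontr)
    assume "\<not> (\<exists>j\<le>k. a j \<noteq> 0)"
    then have "x (Suc k) = s" using a by (simp add: less_Suc_eq_le)
    then obtain d where d: "d \<in> S" "\<phi> (x k) = \<phi> d" using onto[OF s] x_Suc by metis
    then have "\<phi> (x k - d) = 0" using \<phi>_diff xX SX by auto
    then have "x k - d = 0" using \<phi>_inj xX d(1) SX X by (meson subsetD vec.subspace_diff)
    then have "x k \<in> S" using d(1) by simp
    then show False using xk by (blast intro: vec.span_base)
  qed
  then obtain j where j: "j \<le> k" "a j \<noteq> 0" by blast
  then obtain t b where t: "t \<noteq> 0" and b0: "b 0 = a 0 * t"
    and bS: "\<And>i. i < k \<Longrightarrow> b (Suc i) = b i ^ Q + a (Suc i) * t" and bk: "b k ^ Q = t"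
    using fixed_vector_recursion[OF Q j(1), of a] j(2) by blast
  define v where "v = (\<Sum>i<Suc k. b i *s x i)"
  have vX: "v \<in> X" unfolding v_def using \<phi>_sum[of "{..<Suc k}" "\<lambda>i. b i *s x i"] xX X by (auto simp: vec.subspace_scale)
  have "\<phi> v = (\<Sum>i<Suc k. b i ^ Q *s x (Suc i))"
    unfolding v_def using \<phi>_sum[of "{..<Suc k}" "\<lambda>i. b i *s x i"] xX X
    by (simp add: vec.subspace_scale \<phi>_scale x_Suc del: sum.lessThan_Suc)
  also have "\<dots> = (\<Sum>i<k. b i ^ Q *s x (Suc i)) + t *s x (Suc k)" by (simp add: bk)
  also have "t *s x (Suc k) = t *s s + (\<Sum>i<Suc k. (a i * t) *s x i)"
    unfolding a by (simp add: vec.scale_right_distrib vec.scale_sum_right mult.commute del: sum.lessThan_Suc)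
  also have "(\<Sum>i<k. b i ^ Q *s x (Suc i)) + (t *s s + (\<Sum>i<Suc k. (a i * t) *s x i)) =
      t *s s + ((a 0 * t) *s x 0 + (\<Sum>i<k. (b i ^ Q + a (Suc i) * t) *s x (Suc i)))"
    unfolding sum.lessThan_Suc_shift by (simp add: sum.distrib vec.scale_left_distrib algebra_simps)
  also have "\<dots> = t *s s + v"
    unfolding v_def sum.lessThan_Suc_shift by (simp add: b0 bS)
  finally have \<phi>v: "\<phi> v = t *s s + v" .
  obtain d where d: "d \<in> S" "\<phi> d - d = (- t) *s s" using onto1[of "(- t) *s s"] s S by (metis vec.subspace_scale)
  have "\<phi> (v + d) = v + d"
    using \<phi>_add[OF vX] d SX by (auto simp: \<phi>v algebra_simps)
  then have "v + d \<in> S"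
    unfolding S_def using vX d(1) SX X by (intro vec.span_base) (auto intro: vec.subspace_add)
  then have "v \<in> S" using d(1) S by (metis add_diff_cancel_right' vec.subspace_diff)
  have "b k \<noteq> 0" using bk t Q by auto
  have "b k *s x k = v - (\<Sum>i<k. b i *s x i)" by (simp add: v_def)
  also have "\<dots> \<in> vec.span (S \<union> x ` {..<k})"
    using \<open>v \<in> S\<close> by (intro vec.span_diff vec.span_sum vec.span_scale vec.span_base) auto
  finally have "inverse (b k) *s (b k *s x k) \<in> vec.span (S \<union> x ` {..<k})" by (rule vec.span_scale)
  then show False using xk \<open>b k \<noteq> 0\<close> by simp
qed


text \<open>
The characteristic of the field enters only through the inherited assumption that the \<open>q\<close>-th power map is an
additive bijection.
\<close>

locale frobenius_sesquilinear = sesquilinear "\<lambda>a. a ^ q" \<beta>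
  for q :: nat and \<beta> :: "'a::alg_closed_field^'n \<Rightarrow> 'a^'n \<Rightarrow> 'a" +
  assumes q_gt_1: "q > 1"
begin

text \<open>
The map \<open>\<phi>\<close> with \<open>\<beta> y (\<phi> x) = (\<beta> x y)^q\<close> is \<open>q^2\<close>-semilinear and injective, so its fixed vectors span \<open>X\<close>. For a
fixed vector \<open>v\<close> the functionals \<open>\<beta> v _\<close> and \<open>\<beta> _ v\<close> have the same kernel, and it remains to find one with
\<open>\<beta> v v \<noteq> 0\<close>. Two fixed vectors with \<open>\<beta> v w \<noteq> 0\<close> exist; if both are isotropic, some \<open>v + c w\<close>
with \<open>c\<close> in the field of \<open>q^2\<close> elements is not.
\<close>

lemma anisotropic_vector:
  assumes X: "vec.subspace X" and R: "right_radical X = {0}" and "\<not> X \<subseteq> {0}"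
  shows "\<exists>v\<in>X. \<beta> v v = 1 \<and> (\<forall>y\<in>X. \<beta> v y = 0 \<longleftrightarrow> \<beta> y v = 0)"
proof -
  have L: "left_radical X = {0}" using left_radical_trivial[OF X R] .
  have "\<exists>z\<in>X. \<forall>y\<in>X. \<beta> y z = (\<beta> x y) ^ q" for x
    by (rule represent_functional[OF X R]) (auto simp: expand \<sigma>_add power_mult_distrib)
  then obtain \<phi> where \<phi>X: "\<And>x. \<phi> x \<in> X" and \<phi>: "\<And>x y. y \<in> X \<Longrightarrow> \<beta> y (\<phi> x) = (\<beta> x y) ^ q"
    by metis
  have uniq: "z = z'" if "z \<in> X" "z' \<in> X" "\<And>y. y \<in> X \<Longrightarrow> \<beta> y z = \<beta> y z'" for z z'
  proof -
    have "z - z' \<in> right_radical X"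
      using that X by (auto simp: right_radical_def expand vec.subspace_diff)
    then show ?thesis using R by simp
  qed
  let ?Fix = "{v \<in> X. \<phi> v = v}"
  have span: "X \<subseteq> vec.span ?Fix"
  proof (rule span_fixed_vectors[of "q * q"])
    show "q * q > 1" using q_gt_1 by (metis less_1_mult)
    show "\<phi> (x + y) = \<phi> x + \<phi> y" if "x \<in> X" "y \<in> X" for x y
      by (rule uniq) (use X \<phi>X \<phi> in \<open>auto simp: expand \<sigma>_add vec.subspace_add\<close>)
    show "\<phi> (c *s x) = c ^ (q * q) *s \<phi> x" if "x \<in> X" for c x
      by (rule uniq) (use X \<phi>X \<phi> in \<open>auto simp: expand power_mult_distrib power_mult vec.subspace_scale\<close>)
    show "x = 0" if "x \<in> X" "\<phi> x = 0" for x
    proof -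
      have "\<beta> x y = 0" if "y \<in> X" for y
        using \<phi>[OF that, of x] \<open>\<phi> x = 0\<close> by simp
      then show ?thesis using that L by (auto simp: left_radical_def)
    qed
  qed (use X \<phi>X in auto)
  have fix_swap: "\<beta> y v = (\<beta> v y) ^ q" if "v \<in> ?Fix" "y \<in> X" for v y
    using \<phi>[of y v] that by auto
  obtain v w where vw: "v \<in> ?Fix" "w \<in> ?Fix" "\<beta> v w \<noteq> 0"
  proof (rule ccontr)
    assume "\<not> thesis"
    with that have a: "\<beta> v w = 0" if "v \<in> ?Fix" "w \<in> ?Fix" for v w using that by blast
    have "v = 0" if v: "v \<in> ?Fix" for v
    proof -
      have "\<beta> v y = 0" if "y \<in> X" for y
        using right_zero_on_span[of ?Fix v y] v that a span by blast
      then show ?thesis using v L by (auto simp: left_radical_def)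
    qed
    then have "vec.span ?Fix \<subseteq> vec.span {0}" by (intro vec.span_mono) auto
    then show False using span \<open>\<not> X \<subseteq> {0}\<close> by auto
  qed
  have "\<exists>u\<in>?Fix. \<beta> u u \<noteq> 0"
  proof (cases "\<beta> v v = 0 \<and> \<beta> w w = 0")
    case False then show ?thesis using vw by blast
  next
    case True
    (* The polarisation of \<beta> u u is d + d^q where c = d / c0. An element d with d + d^q = 1 satisfies
       d^(q^2) = d automatically, so u stays fixed; this also covers characteristic 2, where
       d = 1 would fail. *)
    define c0 where "c0 = \<beta> v w"
    have wv: "\<beta> w v = c0 ^ q" using fix_swap[of v w] vw by (simp add: c0_def)
    then have c0: "(c0 ^ q) ^ q = c0" using fix_swap[of w v] vw by (simp add: c0_def)
    obtain d where d: "d ^ q + d = (1 :: 'a)" using root_additive_polynomial[OF q_gt_1, of 1 1] by auto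
    then have dq: "d ^ q = 1 - d" by (simp add: algebra_simps)
    have "(1 - d) ^ q + d ^ q = 1" using \<sigma>_add[of "1 - d" d] by simp
    then have dqq: "(d ^ q) ^ q = d" unfolding dq by (simp add: algebra_simps)
    define c where "c = d / c0"
    have cqq: "(c ^ q) ^ q = c" unfolding c_def by (simp add: power_divide c0 dqq)
    define u where "u = v + c *s w"
    have uX: "u \<in> X" using vw X by (auto simp: u_def vec.subspace_add vec.subspace_scale)
    have "\<phi> u = u"
    proof (rule uniq[OF \<phi>X uX])
      fix y assume "y \<in> X"
      then show "\<beta> y (\<phi> u) = \<beta> y u"
        using \<phi>[of y u] fix_swap[of v y] fix_swap[of w y] vw
        by (simp add: u_def expand \<sigma>_add power_mult_distrib cqq)
    qed
    moreover have "\<beta> u u = 1"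
    proof -
      have "\<beta> u u = c * c0 + c ^ q * c0 ^ q"
        using True by (simp add: u_def expand wv c0_def[symmetric])
      also have "\<dots> = d + d ^ q" using vw(3) by (simp add: c_def c0_def power_divide)
      finally show ?thesis using d by (simp add: add.commute)
    qed
    ultimately show ?thesis using uX by auto
  qed
  then obtain u where u: "u \<in> ?Fix" "\<beta> u u \<noteq> 0" by blast
  obtain s where s: "s ^ (q + 1) = inverse (\<beta> u u)"
    using nth_root_exists[of "q + 1" "inverse (\<beta> u u)"] by auto
  have "s \<noteq> 0" using s u(2) by auto
  have "\<beta> (s *s u) (s *s u) = s ^ (q + 1) * \<beta> u u" by (simp add: expand)
  then have "\<beta> (s *s u) (s *s u) = 1" using s u(2) by simp
  moreover have "\<beta> (s *s u) y = 0 \<longleftrightarrow> \<beta> y (s *s u) = 0" if "y \<in> X" for y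
    using fix_swap[OF u(1) that] \<open>s \<noteq> 0\<close> q_gt_1 by (simp add: expand)
  ultimately show ?thesis
    using u(1) X by (intro bexI[of _ "s *s u"]) (auto simp: vec.subspace_scale)
qed

lemma orthonormal_basis:
  assumes "vec.subspace X" and "right_radical X = {0}"
  shows "\<exists>bs. length bs = vec.dim X \<and> set bs \<subseteq> X \<and> vec.span (set bs) = X \<and>
    (\<forall>i<length bs. \<forall>j<length bs. \<beta> (bs ! i) (bs ! j) = (if i = j then 1 else 0))"
  using assms
proof (induction "vec.dim X" arbitrary: X)
  case 0
  have "X \<subseteq> {0}" using 0(1) vec.dim_eq_0[of X] by metis
  moreover have "0 \<in> X" using 0(2) by (rule vec.subspace_0)
  ultimately have "X = {0}" by blast
  then show ?case by (intro exI[of _ "[]"]) (simp only: vec.dim_singleton list.size set_simps vec.span_empty, simp)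
next
  case (Suc n)
  have "\<not> X \<subseteq> {0}"
  proof
    assume "X \<subseteq> {0}"
    then have "vec.dim X = 0" by (simp only: vec.dim_eq_0)
    then show False using Suc.hyps(2) by (simp only: nat.distinct)
  qed
  then obtain v where v: "v \<in> X" "\<beta> v v = 1" and perp: "\<And>y. y \<in> X \<Longrightarrow> \<beta> v y = 0 \<longleftrightarrow> \<beta> y v = 0"
    using anisotropic_vector[OF Suc.prems] by blast
  define Y where "Y = {y \<in> X. \<beta> v y = 0}"
  note Y = right_perp[OF Suc.prems(1), of v, folded Y_def] right_perp(2,3)[OF Suc.prems(1), of v v, folded Y_def]
  have spanY: "vec.span (insert v Y) = X" and dimY: "vec.dim X = Suc (vec.dim Y)"
    using Y(4,5) v by auto
  have "right_radical Y \<subseteq> right_radical X"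
  proof
    fix y assume y: "y \<in> right_radical Y"
    have "\<beta> x y = 0" if "x \<in> X" for x
      using left_zero_on_span[of "insert v Y" y x] spanY that y
      by (auto simp: right_radical_def Y_def)
    then show "y \<in> right_radical X" using y by (auto simp: right_radical_def Y_def)
  qed
  then have radY: "right_radical Y = {0}"
    using Suc.prems(2) vec.subspace_0[OF subspace_right_radical[OF Y(1)]] by auto
  have "n = vec.dim Y" using Suc.hyps(2) dimY by (simp only: nat.inject)
  from Suc.hyps(1)[OF this Y(1) radY] obtain bs where bs: "length bs = vec.dim Y" "set bs \<subseteq> Y" "vec.span (set bs) = Y"
    "\<forall>i<length bs. \<forall>j<length bs. \<beta> (bs ! i) (bs ! j) = (if i = j then 1 else 0)"
    by blast
  have "vec.span (set (v # bs)) = X"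
    using spanY vec.span_Un[of "{v}" "set bs"] vec.span_Un[of "{v}" Y] bs(3) Y(1)
    by (simp add: vec.span_eq_iff[THEN iffD2])
  moreover have "\<beta> ((v # bs) ! i) ((v # bs) ! j) = (if i = j then 1 else 0)"
    if "i < length (v # bs)" "j < length (v # bs)" for i j
  proof -
    have "\<beta> v (bs ! k) = 0 \<and> \<beta> (bs ! k) v = 0" if "k < length bs" for k
      using perp[of "bs ! k"] bs(2) nth_mem[OF that] by (auto simp: Y_def)
    then show ?thesis using that v(2) bs(4) by (auto simp: nth_Cons split: nat.splits)
  qed
  moreover have "set (v # bs) \<subseteq> X" using bs(2) v by (auto simp: Y_def)
  moreover have "length (v # bs) = vec.dim X" using bs(1) dimY by (simp only: list.size add_0_right add_Suc_right)
  ultimately show ?case by blast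
qed

end

section \<open>Chains and hyperbolic planes\<close>

lemma span_insert_cong: "vec.span B = W \<Longrightarrow> vec.span (insert a B) = vec.span (insert a W)"
  for a :: "'a::field^'n"
  by (auto simp: vec.span_insert vec.span_span)

lemma subspace_eq_dimI:
  fixes S :: "('a::field^'n) set"
  assumes "S \<subseteq> T" "vec.subspace S" "vec.subspace T" "vec.dim S = vec.dim T"
  shows "S = T"
  using assms by (intro vec.subspace_dim_equal) auto

lemma dim_1_imp_span_singleton:
  fixes S :: "('a::field^'n) set"
  assumes "vec.subspace S" "vec.dim S = 1"
  shows "\<exists>x. x \<noteq> 0 \<and> S = vec.span {x}"
proof -
  obtain B where B: "B \<subseteq> S" "vec.independent B" "S \<subseteq> vec.span B" "card B = vec.dim S"
    using vec.basis_exists by blast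
  then obtain x where "B = {x}" using assms(2) by (metis card_1_singletonE)
  then show ?thesis using B assms(1) vec.span_subspace[of B S] by (intro exI[of _ x]) auto
qed

context sesquilinear
begin

definition gram :: "('a^'n) list \<Rightarrow> 'a list list" where
  "gram vs = map (\<lambda>x. map (\<beta> x) vs) vs"

text \<open>
If \<open>X\<close> is spanned by \<open>W\<close> and vectors orthogonal to \<open>W\<close> on both sides, then a vector of \<open>W\<close> that is
orthogonal to \<open>W\<close> is orthogonal to all of \<open>X\<close>.
\<close>

lemma radicals_extend:
  assumes "X = vec.span (B \<union> W)" "W \<subseteq> X" and "\<And>b w. b \<in> B \<Longrightarrow> w \<in> W \<Longrightarrow> \<beta> b w = 0 \<and> \<beta> w b = 0"
  shows "right_radical W = right_radical X \<inter> W" and "left_radical W = left_radical X \<inter> W"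
proof -
  have "\<beta> x y = 0" if "y \<in> right_radical W" "x \<in> X" for x y
  proof (rule left_zero_on_span)
    show "x \<in> vec.span (B \<union> W)" using that(2) unfolding assms(1) .
    show "\<beta> b y = 0" if "b \<in> B \<union> W" for b
      using that \<open>y \<in> right_radical W\<close> assms(3) by (auto simp: right_radical_def)
  qed
  then show "right_radical W = right_radical X \<inter> W"
    using assms(2) by (auto simp: right_radical_def)
  have "\<beta> x y = 0" if "x \<in> left_radical W" "y \<in> X" for x y
  proof (rule right_zero_on_span)
    show "y \<in> vec.span (B \<union> W)" using that(2) unfolding assms(1) .
    show "\<beta> x b = 0" if "b \<in> B \<union> W" for b
      using that \<open>x \<in> left_radical W\<close> assms(3) by (auto simp: left_radical_def)
  qed
  then show "left_radical W = left_radical X \<inter> W"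
    using assms(2) by (auto simp: left_radical_def)
qed

text \<open>
The pair \<open>r\<close>, \<open>l\<close> is a chain \<open>J_2\<close> and \<open>W\<close> is its orthogonal complement; of the four orthogonality conditions two
hold on all of \<open>X\<close>. Each of the other two is a hyperplane condition that one of \<open>l\<close>, \<open>r\<close>
violates, which gives both the dimension and the spanning statement.
\<close>

lemma split_path2:
  assumes X: "vec.subspace X" and r: "r \<in> right_radical X" and l: "l \<in> left_radical X"
    and rl: "\<beta> r l = 1" and W_def: "W = {x \<in> X. \<beta> r x = 0 \<and> \<beta> x l = 0}"
  shows "vec.subspace W" and "vec.dim X = vec.dim W + 2"
    and "vec.span B = W \<Longrightarrow> vec.span (insert r (insert l B)) = X"
    and "right_radical W = right_radical X \<inter> W" and "left_radical W = left_radical X \<inter> W"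
proof -
  define Y where "Y = {x \<in> X. \<beta> r x = 0}"
  have W: "W = {x \<in> Y. \<beta> x l = 0}" by (auto simp: W_def Y_def)
  have lX: "l \<in> X" and rY: "r \<in> Y" using r l by (auto simp: left_radical_def right_radical_def Y_def)
  have ne: "\<beta> r l \<noteq> 0" using rl by simp
  note Y = right_perp(1)[OF X, of r, folded Y_def] right_perp(2,3)[OF X lX ne, folded Y_def]
  note WY = left_perp(1)[OF Y(1), of l, folded W] left_perp(2,3)[OF Y(1) rY ne, folded W]
  show subW: "vec.subspace W" by (fact WY(1))
  show "vec.dim X = vec.dim W + 2" using Y(3) WY(3) by simp
  have span: "vec.span (insert r (insert l B)) = X" if "vec.span B = W" for B
  proof -
    have "vec.span (insert r B) = Y" using span_insert_cong[OF that] WY(2) by simp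
    then show ?thesis unfolding insert_commute[of r l] using span_insert_cong[of "insert r B" Y l] Y(2) by simp
  qed
  then show "vec.span B = W \<Longrightarrow> vec.span (insert r (insert l B)) = X" .
  have XW: "X = vec.span ({r, l} \<union> W)" and WX: "W \<subseteq> X"
    using span[of W] subW by (auto simp: vec.span_eq_iff[THEN iffD2] W_def)
  have orth: "\<beta> b w = 0 \<and> \<beta> w b = 0" if "b \<in> {r, l}" "w \<in> W" for b w
    using that r l by (auto simp: W_def right_radical_def left_radical_def)
  show "right_radical W = right_radical X \<inter> W" "left_radical W = left_radical X \<inter> W"
    using radicals_extend[OF XW WX orth] by blast+
qed

text \<open>
Here \<open>r\<close>, \<open>v\<close>, \<open>l\<close> is a chain \<open>J_3\<close>. Its orthogonal complement \<open>W\<close> has codimension three and not four because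
the conditions \<open>\<beta> r x = 0\<close> and \<open>\<beta> x l = 0\<close> agree.
\<close>

lemma split_path3:
  assumes X: "vec.subspace X" and r: "r \<in> right_radical X" and l: "l \<in> left_radical X"
    and v: "v \<in> X" "\<beta> v v = 0" "\<beta> r v = 1" "\<beta> v l = 1"
    and perp: "\<And>x. x \<in> X \<Longrightarrow> \<beta> r x = 0 \<longleftrightarrow> \<beta> x l = 0" and rl: "\<beta> r l = 0"
    and W_def: "W = {x \<in> X. \<beta> r x = 0 \<and> \<beta> v x = 0 \<and> \<beta> x v = 0}"
  shows "vec.subspace W" and "vec.dim X = vec.dim W + 3"
    and "vec.span B = W \<Longrightarrow> vec.span (insert r (insert v (insert l B))) = X"
    and "right_radical W = right_radical X \<inter> W" and "left_radical W = left_radical X \<inter> W"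
proof -
  define Y where "Y = {x \<in> X. \<beta> r x = 0}"
  define Z where "Z = {x \<in> Y. \<beta> v x = 0}"
  have W: "W = {x \<in> Z. \<beta> x v = 0}" by (auto simp: W_def Y_def Z_def)
  have lY: "l \<in> Y" and rZ: "r \<in> Z"
    using r l v rl by (auto simp: left_radical_def right_radical_def Y_def Z_def)
  have ne: "\<beta> r v \<noteq> 0" "\<beta> v l \<noteq> 0" using v by simp_all
  note Y = right_perp(1)[OF X, of r, folded Y_def] right_perp(2,3)[OF X v(1) ne(1), folded Y_def]
  note Z = right_perp(1)[OF Y(1), of v, folded Z_def] right_perp(2,3)[OF Y(1) lY ne(2), folded Z_def]
  note WZ = left_perp(1)[OF Z(1), of v, folded W] left_perp(2,3)[OF Z(1) rZ ne(1), folded W]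
  show subW: "vec.subspace W" by (fact WZ(1))
  show "vec.dim X = vec.dim W + 3" using Y(3) Z(3) WZ(3) by simp
  have span: "vec.span (insert r (insert v (insert l B))) = X" if "vec.span B = W" for B
  proof -
    have "insert r (insert v (insert l B)) = insert v (insert l (insert r B))" by blast
    moreover have "vec.span (insert r B) = Z" using span_insert_cong[OF that] WZ(2) by simp
    then have "vec.span (insert l (insert r B)) = Y" using span_insert_cong[of "insert r B" Z l] Z(2) by simp
    then have "vec.span (insert v (insert l (insert r B))) = X" using span_insert_cong[of "insert l (insert r B)" Y v] Y(2) by simp
    ultimately show ?thesis by simp
  qed
  then show "vec.span B = W \<Longrightarrow> vec.span (insert r (insert v (insert l B))) = X" .
  have XW: "X = vec.span ({r, v, l} \<union> W)" and WX: "W \<subseteq> X"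
    using span[of W] subW by (auto simp: vec.span_eq_iff[THEN iffD2] W_def)
  have orth: "\<beta> b w = 0 \<and> \<beta> w b = 0" if "b \<in> {r, v, l}" "w \<in> W" for b w
    using that r l perp by (auto simp: W_def right_radical_def left_radical_def)
  show "right_radical W = right_radical X \<inter> W" "left_radical W = left_radical X \<inter> W"
    using radicals_extend[OF XW WX orth] by blast+
qed

lemma path2_if_radicals_not_orthogonal:
  assumes "r \<in> right_radical X" and "l \<in> left_radical X" and "\<beta> r l \<noteq> 0" and "vec.subspace X"
  shows "\<exists>l' \<in> left_radical X. \<beta> r l' = 1"
  using assms subspace_left_radical[OF assms(4)]
  by (intro bexI[of _ "inverse (\<beta> r l) *s l"]) (auto simp: expand vec.subspace_scale)

text \<open>
Any vector with \<open>\<beta> r v = 1\<close> can serve as the middle of the chain: adding a multiple of \<open>r\<close> makes it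
isotropic, and it is not orthogonal to \<open>l\<close> because it lies outside the common hyperplane.
\<close>

lemma path3_if_perps_equal:
  assumes X: "vec.subspace X" and r: "r \<in> right_radical X" "r \<notin> left_radical X" and l: "l \<in> left_radical X"
    and perp: "\<And>x. x \<in> X \<Longrightarrow> \<beta> r x = 0 \<longleftrightarrow> \<beta> x l = 0"
  shows "\<exists>v l'. l' \<in> left_radical X \<and> v \<in> X \<and> \<beta> v v = 0 \<and> \<beta> r v = 1 \<and> \<beta> v l' = 1 \<and>
    (\<exists>c. c \<noteq> 0 \<and> l' = c *s l)"
proof -
  have rX: "r \<in> X" using r(1) by (simp add: right_radical_def)
  obtain w where w: "w \<in> X" "\<beta> r w \<noteq> 0" using r rX by (auto simp: left_radical_def)
  define u where "u = inverse (\<beta> r w) *s w"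
  have u: "u \<in> X" "\<beta> r u = 1" using w X by (auto simp: u_def expand vec.subspace_scale)
  obtain a where a: "\<sigma> a = - \<beta> u u" using \<sigma>_surj by blast
  define v where "v = u + a *s r"
  have r0: "\<beta> x r = 0" if "x \<in> X" for x using r(1) that by (simp add: right_radical_def)
  have v: "v \<in> X" "\<beta> r v = 1" "\<beta> v v = 0"
    using u rX X a r0[OF rX] r0[OF u(1)] by (auto simp: v_def expand vec.subspace_add vec.subspace_scale)
  then have "\<beta> v l \<noteq> 0" using perp by force
  then show ?thesis
    using v l subspace_left_radical[OF X]
    by (intro exI[of _ v] exI[of _ "inverse (\<beta> v l) *s l"])
       (auto simp: expand vec.subspace_scale intro!: exI[of _ "inverse (\<beta> v l)"])
qed

text \<open>
After a chain starting at \<open>r\<close> is split off, the radical line through \<open>r\<close> leaves the complement, which is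
therefore nondegenerate.
\<close>

lemma right_radical_line_meets_split:
  assumes "right_radical X = vec.span {r}" "right_radical W = right_radical X \<inter> W"
    and "vec.subspace W" "\<beta> r w \<noteq> 0" "\<And>x. x \<in> W \<Longrightarrow> \<beta> x w = 0"
  shows "right_radical W = {0}"
proof -
  have "c = 0" if "c *s r \<in> W" for c
    using assms(5)[OF that] assms(4) by (simp add: expand)
  then show ?thesis using assms vec.subspace_0[OF assms(3)] by (auto simp: vec.span_singleton)
qed

end

context frobenius_sesquilinear
begin

lemma orthonormal_triple:
  assumes "vec.subspace W" "right_radical W = {0}" "vec.dim W = 3"
  shows "\<exists>a b c. vec.span {a, b, c} = W \<and> gram [a, b, c] = [[1,0,0],[0,1,0],[0,0,1]]"
proof -
  obtain bs where bs: "length bs = 3" "vec.span (set bs) = W"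
    "\<forall>i<length bs. \<forall>j<length bs. \<beta> (bs ! i) (bs ! j) = (if i = j then 1 else 0)"
    using orthonormal_basis[OF assms(1,2)] assms(3) by metis
  then obtain a b c where "bs = [a, b, c]" by (auto simp: length_Suc_conv numeral_eq_Suc)
  with bs show ?thesis
    by (intro exI[of _ a] exI[of _ b] exI[of _ c])
       (auto simp: gram_def nth_Cons' All_less_Suc numeral_3_eq_3)
qed

lemma orthonormal_pair:
  assumes "vec.subspace W" "right_radical W = {0}" "vec.dim W = 2"
  shows "\<exists>a b. vec.span {a, b} = W \<and> gram [a, b] = [[1,0],[0,1]]"
proof -
  obtain bs where bs: "length bs = 2" "vec.span (set bs) = W"
    "\<forall>i<length bs. \<forall>j<length bs. \<beta> (bs ! i) (bs ! j) = (if i = j then 1 else 0)"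
    using orthonormal_basis[OF assms(1,2)] assms(3) by metis
  then obtain a b where "bs = [a, b]" by (auto simp: length_Suc_conv numeral_eq_Suc)
  with bs show ?thesis
    by (intro exI[of _ a] exI[of _ b]) (auto simp: gram_def nth_Cons' All_less_Suc numeral_2_eq_2)
qed

lemma unit_vector:
  assumes "vec.subspace W" "right_radical W = {0}" "vec.dim W = 1"
  shows "\<exists>a. vec.span {a} = W \<and> \<beta> a a = 1"
proof -
  obtain bs where bs: "length bs = 1" "vec.span (set bs) = W"
    "\<forall>i<length bs. \<forall>j<length bs. \<beta> (bs ! i) (bs ! j) = (if i = j then 1 else 0)"
    using orthonormal_basis[OF assms(1,2)] assms(3) by metis
  then obtain a where "bs = [a]" by (auto simp: length_Suc_conv)
  with bs show ?thesis by auto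
qed

text \<open>
Two of the representatives contain a hyperbolic plane \<open>x^q y + y^q x\<close> instead of a sum of two powers.
The vector \<open>u = a + t b\<close> with \<open>t^(q+1) = -1\<close> is isotropic, and \<open>a\<close> satisfies \<open>\<beta> u a = \<beta> a u = 1\<close>, so
it only has to be made isotropic by a multiple of \<open>u\<close>.
\<close>

lemma hyperbolic_pair:
  assumes "gram [a, b] = [[1,0],[0,1]]"
  shows "\<exists>u w. vec.span (insert u (insert w S)) = vec.span (insert a (insert b S)) \<and> gram [u, w] = [[0,1],[1,0]] \<and>
    u \<in> vec.span {a, b} \<and> w \<in> vec.span {a, b}"
proof -
  obtain t where t: "t ^ (q + 1) = (-1 :: 'a)" using nth_root_exists[of "q + 1" "-1"] by auto
  then have t': "t * t ^ q = -1" by simp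
  have "t \<noteq> 0" using t by auto
  obtain c where "c ^ q + 1 * c = (-1 :: 'a)" using root_additive_polynomial[OF q_gt_1] by blast
  then have c: "c ^ q = - 1 - c" by (simp add: algebra_simps)
  define u where "u = a + t *s b"
  define w where "w = a + c *s u"
  have uab: "u \<in> vec.span {a, b}" by (simp add: u_def vec.span_add vec.span_base vec.span_scale)
  then have wab: "w \<in> vec.span {a, b}" by (simp add: w_def vec.span_add vec.span_base vec.span_scale)
  have a: "a \<in> vec.span {u, w}"
  proof -
    have "a = w - c *s u" by (simp add: w_def)
    then show ?thesis by (metis insertI1 insert_commute vec.span_base vec.span_diff vec.span_scale)
  qed
  have b: "b \<in> vec.span {u, w}"
  proof -
    have "b = inverse t *s (u - a)" using \<open>t \<noteq> 0\<close> by (simp add: u_def)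
    then show ?thesis using a by (metis insertI1 vec.span_base vec.span_diff vec.span_scale)
  qed
  have "vec.span (insert u (insert w S)) = vec.span (insert a (insert b S))"
    unfolding vec.span_eq using a b uab wab
      vec.span_mono[of "{a, b}" "insert a (insert b S)"] vec.span_mono[of "{u, w}" "insert u (insert w S)"]
    by (auto intro: vec.span_base)
  moreover have "gram [u, w] = [[0,1],[1,0]]"
    using assms t' by (simp add: gram_def u_def w_def expand c power_mult_distrib algebra_simps)
  ultimately show ?thesis using uab wab by blast
qed

end

text \<open>
The Gram matrix prescribed by a directed graph on the vertices \<open>1, ..., 5\<close>: an edge \<open>(i, j)\<close> stands for the term
\<open>x_i^q x_j\<close>. In the graphs below a path with \<open>k\<close> vertices is a chain \<open>J_k\<close>, and loops and \<open>2\<close>-cycles make up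
the nondegenerate part.
\<close>

definition pattern :: "(nat \<times> nat) set \<Rightarrow> 'a::zero_neq_one list list" where
  "pattern E = map (\<lambda>i. map (\<lambda>j. of_bool ((i, j) \<in> E)) [1, 2, 3, 4, 5]) [1, 2, 3, 4, 5]"

definition graph_F5 :: "(nat \<times> nat) set" where
  "graph_F5 = {(1,1), (2,2), (3,3), (4,4), (5,5)}"

definition graph_J2_F3 :: "(nat \<times> nat) set" where
  "graph_J2_F3 = {(1,5), (2,4), (3,3), (4,2)}"

definition graph_J4_F1 :: "(nat \<times> nat) set" where
  "graph_J4_F1 = {(1,5), (2,4), (3,3), (4,1)}"

definition graph_J5 :: "(nat \<times> nat) set" where
  "graph_J5 = {(1,5), (2,4), (3,2), (4,1)}"

definition graph_J3_F2 :: "(nat \<times> nat) set" where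
  "graph_J3_F2 = {(1,5), (2,3), (3,2), (4,1)}"

definition graph_J2_J2_F1 :: "(nat \<times> nat) set" where
  "graph_J2_J2_F1 = {(1,5), (2,4), (3,3)}"

definition graph_J3_J2 :: "(nat \<times> nat) set" where
  "graph_J3_J2 = {(1,5), (2,4), (3,2)}"

lemmas graph_defs = graph_F5_def graph_J2_F3_def graph_J4_F1_def graph_J5_def graph_J3_F2_def graph_J2_J2_F1_def graph_J3_J2_def

definition quinary_graphs :: "(nat \<times> nat) set list" where
  "quinary_graphs =
    [graph_F5, graph_J2_F3, graph_J4_F1, graph_J5, graph_J3_F2, graph_J2_J2_F1, graph_J3_J2]"

context sesquilinear
begin

definition adapted :: "(nat \<times> nat) set \<Rightarrow> bool" where
  "adapted E \<longleftrightarrow> (\<exists>vs. vec.span (set vs) = UNIV \<and> gram vs = pattern E)"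

lemma adaptedI:
  assumes "vec.span {a, b, c, d, e} = UNIV" and "gram [a, b, c, d, e] = pattern E"
  shows "adapted E"
  unfolding adapted_def using assms by (intro exI[of _ "[a, b, c, d, e]"]) auto

end

context frobenius_sesquilinear
begin

lemma adapted_nondegenerate:
  assumes "vec.dim (UNIV :: ('a^'n) set) = 5" and "right_radical UNIV = {0}"
  shows "adapted graph_F5"
proof -
  obtain bs where bs: "length bs = 5" "vec.span (set bs) = UNIV"
    "\<forall>i<length bs. \<forall>j<length bs. \<beta> (bs ! i) (bs ! j) = (if i = j then 1 else 0)"
    using orthonormal_basis[OF vec.subspace_UNIV assms(2)] assms(1) by metis
  then obtain a b c d e where bs': "bs = [a, b, c, d, e]"
    by (auto simp: length_Suc_conv numeral_eq_Suc)
  have "\<beta> (bs ! i) (bs ! j) = (if i = j then 1 else 0)" if "i < 5" "j < 5" for i j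
    using bs that by auto
  then have "\<beta> (bs ! i) (bs ! j) = of_bool (i = j)" if "i \<in> set [0,1,2,3,4]" "j \<in> set [0,1,2,3,4]" for i j
    using that by auto
  then have "map (\<lambda>i. map (\<lambda>j. \<beta> (bs ! i) (bs ! j)) [0,1,2,3,4]) [0,1,2,3,4] =
      map (\<lambda>i. map (\<lambda>j. of_bool (i = j)) [0,1,2,3,4]) [0,1,2,3,4::nat]"
    by (intro map_cong refl) blast
  then have "gram [a, b, c, d, e] = pattern graph_F5"
    by (simp add: gram_def pattern_def graph_defs bs')
  moreover have "vec.span {a, b, c, d, e} = UNIV" using bs(2) bs' by simp
  ultimately show ?thesis by (intro adaptedI)
qed

lemma corank_one_not_orthogonal:
  assumes dim: "vec.dim (UNIV :: ('a^'n) set) = 5"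
    and r: "right_radical UNIV = vec.span {r}" and l: "l \<in> left_radical UNIV" and rl: "\<beta> r l \<noteq> 0"
  shows "adapted graph_J2_F3"
proof -
  have rR: "r \<in> right_radical UNIV" by (simp add: r vec.span_base)
  obtain l where l: "l \<in> left_radical UNIV" and rl: "\<beta> r l = 1"
    using path2_if_radicals_not_orthogonal[OF rR l rl] by auto
  define W where "W = {x \<in> UNIV. \<beta> r x = 0 \<and> \<beta> x l = 0}"
  note W = split_path2[OF vec.subspace_UNIV rR l rl W_def]
  have radW: "right_radical W = {0}"
    by (rule right_radical_line_meets_split[OF r W(4,1), of l]) (auto simp: rl W_def)
  obtain a b c where abc: "vec.span {a, b, c} = W" "gram [a, b, c] = [[1,0,0],[0,1,0],[0,0,1]]"
    using orthonormal_triple[OF W(1) radW] W(2) dim by auto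
  then have g: "gram [a, b] = [[1,0],[0,1]]" by (simp add: gram_def)
  from hyperbolic_pair[OF g, of "{c}"] obtain u w where uw: "vec.span {u, w, c} = W"
    "gram [u, w] = [[0,1],[1,0]]" "u \<in> vec.span {a, b}" "w \<in> vec.span {a, b}" using abc(1) by metis
  have abc0: "\<beta> a c = 0" "\<beta> b c = 0" "\<beta> c a = 0" "\<beta> c b = 0" "\<beta> c c = 1"
    using abc(2) by (simp_all add: gram_def)
  have c1: "\<beta> x c = 0" if "x \<in> vec.span {a, b}" for x
    using that by (rule left_zero_on_span[rotated]) (auto simp: abc0)
  have c2: "\<beta> c x = 0" if "x \<in> vec.span {a, b}" for x
    using that by (rule right_zero_on_span[rotated]) (auto simp: abc0)
  have "{u, w, c} \<subseteq> W" using vec.span_superset[of "{u, w, c}"] unfolding uw(1) .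
  then have "gram [r, u, c, w, l] = pattern graph_J2_F3"
    using rR l rl uw(2) c1[OF uw(3)] c1[OF uw(4)] c2[OF uw(3)] c2[OF uw(4)] abc0(5)
    by (simp add: gram_def pattern_def graph_defs W_def right_radical_def left_radical_def)
  moreover have "vec.span {r, u, c, w, l} = UNIV"
    using W(3)[OF uw(1)] by (simp add: insert_commute)
  ultimately show ?thesis by (intro adaptedI)
qed

lemma corank_one_perps_equal:
  assumes dim: "vec.dim (UNIV :: ('a^'n) set) = 5"
    and r: "right_radical UNIV = vec.span {r}" and l: "l \<in> left_radical UNIV" and rl: "\<beta> r l = 0"
    and rL: "r \<notin> left_radical UNIV" and perp: "\<And>x. \<beta> r x = 0 \<longleftrightarrow> \<beta> x l = 0"
  shows "adapted graph_J3_F2"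
proof -
  have rR: "r \<in> right_radical UNIV" by (simp add: r vec.span_base)
  obtain v l' c where l': "l' \<in> left_radical UNIV" and v: "\<beta> v v = 0" "\<beta> r v = 1" "\<beta> v l' = 1"
    and c: "c \<noteq> 0" "l' = c *s l"
    using path3_if_perps_equal[OF vec.subspace_UNIV rR rL l perp] by blast
  have perp': "\<beta> r x = 0 \<longleftrightarrow> \<beta> x l' = 0" for x using perp c by (simp add: expand)
  have rl': "\<beta> r l' = 0" using rl by (simp add: c expand)
  define W where "W = {x \<in> UNIV. \<beta> r x = 0 \<and> \<beta> v x = 0 \<and> \<beta> x v = 0}"
  note W = split_path3[OF vec.subspace_UNIV rR l' UNIV_I v perp' rl' W_def]
  have radW: "right_radical W = {0}"
    by (rule right_radical_line_meets_split[OF r W(4,1), of v]) (auto simp: v W_def)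
  obtain a b where ab: "vec.span {a, b} = W" "gram [a, b] = [[1,0],[0,1]]"
    using orthonormal_pair[OF W(1) radW] W(2) dim by auto
  from hyperbolic_pair[OF ab(2), of "{}"] obtain u w where uw: "vec.span {u, w} = W"
    "gram [u, w] = [[0,1],[1,0]]" using ab(1) by metis
  have uwW: "{u, w} \<subseteq> W" using vec.span_superset[of "{u, w}"] unfolding uw(1) .
  then have "\<beta> u l' = 0" "\<beta> w l' = 0" using perp' by (auto simp: W_def)
  then have "gram [v, u, w, r, l'] = pattern graph_J3_F2"
    using uwW rR l' v uw(2) rl'
    by (simp add: gram_def pattern_def graph_defs W_def right_radical_def left_radical_def)
  moreover have "vec.span {v, u, w, r, l'} = UNIV"
    using W(3)[OF uw(1)] by (simp add: insert_commute)
  ultimately show ?thesis by (intro adaptedI)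
qed

end

section \<open>Normal form of a sesquilinear form in dimension five\<close>

lemma span_insert_scale: "c \<noteq> 0 \<Longrightarrow> vec.span (insert (c *s a) S) = vec.span (insert a S)"
  for a :: "'a::field^'n"
proof -
  assume c: "c \<noteq> 0"
  have "c *s a \<in> vec.span (insert a S)" by (intro vec.span_scale vec.span_base) simp
  moreover have "inverse c *s (c *s a) \<in> vec.span (insert (c *s a) S)"
    by (intro vec.span_scale vec.span_base) simp
  ultimately show ?thesis
    using c vec.span_superset[of "insert a S"] vec.span_superset[of "insert (c *s a) S"]
    by (auto simp: vec.span_eq)
qed

context frobenius_sesquilinear
begin

text \<open>
If \<open>R\<close> and \<open>L\<close> were orthogonal, their four-dimensional sum together with one more vector \<open>v\<close> would span the
space. Some nonzero \<open>r\<close> in the two-dimensional \<open>R\<close> satisfies \<open>\<beta> r v = 0\<close>; it would be orthogonal to everything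
and thus lie in \<open>R \<inter> L\<close>.
\<close>

lemma corank_two_radicals_not_orthogonal:
  assumes dim: "vec.dim (UNIV :: ('a^'n) set) = 5"
    and meet: "right_radical UNIV \<inter> left_radical UNIV = {0}" and dimR: "vec.dim (right_radical UNIV) = 2"
  shows "\<exists>r\<in>right_radical UNIV. \<exists>l\<in>left_radical UNIV. \<beta> r l \<noteq> 0"
proof (rule ccontr)
  let ?R = "right_radical UNIV" and ?L = "left_radical UNIV"
  assume "\<not> ?thesis"
  then have orth: "\<beta> r l = 0" if "r \<in> ?R" "l \<in> ?L" for r l using that by blast
  have R: "vec.subspace ?R" and L: "vec.subspace ?L"
    by (simp_all add: subspace_right_radical subspace_left_radical)
  have "vec.dim ?L = 2" using dim_radicals_eq[OF vec.subspace_UNIV] dimR by simp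
  then have "vec.dim {x + y |x y. x \<in> ?R \<and> y \<in> ?L} = 4"
    using vec.dim_sums_Int[OF R L] meet dimR by simp
  moreover have sums: "{x + y |x y. x \<in> ?R \<and> y \<in> ?L} = vec.span (?R \<union> ?L)"
    using R L by (simp add: vec.span_Un vec.span_eq_iff[THEN iffD2])
  ultimately have d4: "vec.dim (?R \<union> ?L) = 4" using vec.dim_span[of "?R \<union> ?L"] by simp
  obtain v where v: "v \<notin> vec.span (?R \<union> ?L)"
  proof (rule ccontr)
    assume "\<not> thesis"
    then have "vec.span (?R \<union> ?L) = UNIV" using that by blast
    then show False using d4 dim vec.dim_span[of "?R \<union> ?L"] by simp
  qed
  have "vec.dim (insert v (?R \<union> ?L)) = 5" using v d4 by (simp add: vec.dim_insert)
  then have span: "vec.span (insert v (?R \<union> ?L)) = UNIV"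
    using dim by (intro subspace_eq_dimI) (simp_all only: vec.dim_span vec.subspace_span vec.subspace_UNIV subset_UNIV)
  have "vec.dim ?R \<le> Suc (vec.dim {x \<in> ?R. \<beta> x v = 0})"
    using sesquilinear.dim_right_perp_le[OF dual R, of v] by simp
  then have "vec.dim {x \<in> ?R. \<beta> x v = 0} \<noteq> 0" using dimR by linarith
  then have "\<not> {x \<in> ?R. \<beta> x v = 0} \<subseteq> {0}" unfolding vec.dim_eq_0 .
  then obtain r where r: "r \<in> ?R" "\<beta> r v = 0" "r \<noteq> 0" by blast
  have "\<beta> r y = 0" for y
  proof (rule right_zero_on_span)
    show "y \<in> vec.span (insert v (?R \<union> ?L))" by (simp add: span)
    show "\<beta> r b = 0" if "b \<in> insert v (?R \<union> ?L)" for b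
    proof -
      have "\<beta> r y = 0" if "y \<in> ?R" for y using that by (simp add: right_radical_def)
      then show ?thesis using that r(2) orth[OF r(1)] by blast
    qed
  qed
  then have "r \<in> ?L" by (simp add: left_radical_def)
  then show False using r meet by blast
qed

text \<open>
In dimension three both hyperplanes are planes containing the independent vectors \<open>r\<close> and \<open>l\<close>.
\<close>

lemma corank_one_dim_three_perps_equal:
  assumes W: "vec.subspace W" "vec.dim W = 3" and r: "r \<in> right_radical W" "r \<notin> left_radical W"
    and l: "l \<in> left_radical W" "l \<notin> right_radical W" and rl: "\<beta> r l = 0" and x: "x \<in> W"
  shows "\<beta> r x = 0 \<longleftrightarrow> \<beta> x l = 0"
proof -
  have rW: "r \<in> W" "l \<in> W" using r l by (auto simp: right_radical_def left_radical_def)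
  have "l \<noteq> 0" using l subspace_right_radical[OF W(1)] vec.subspace_0 by auto
  moreover have "r \<notin> vec.span {l}"
    using r(2) l(1) subspace_left_radical[OF W(1)] by (auto simp: vec.span_singleton vec.subspace_scale)
  ultimately have "vec.dim {r, l} = 2" by (simp add: vec.dim_insert)
  then have d2: "vec.dim (vec.span {r, l}) = 2" by (simp only: vec.dim_span)
  obtain s where s: "s \<in> W" "\<beta> r s \<noteq> 0" using r rW by (auto simp: left_radical_def)
  obtain t where t: "t \<in> W" "\<beta> t l \<noteq> 0" using l rW by (auto simp: right_radical_def)
  have "vec.span {r, l} = {x \<in> W. \<beta> r x = 0}"
  proof (rule subspace_eq_dimI)
    show sub: "vec.subspace {x \<in> W. \<beta> r x = 0}" by (rule right_perp(1)[OF W(1)])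
    show "vec.span {r, l} \<subseteq> {x \<in> W. \<beta> r x = 0}"
      using rW r rl by (intro vec.span_minimal sub) (auto simp: right_radical_def)
    show "vec.dim (vec.span {r, l}) = vec.dim {x \<in> W. \<beta> r x = 0}"
      using right_perp(3)[OF W(1) s] W(2) d2 by simp
  qed simp
  moreover have "vec.span {r, l} = {x \<in> W. \<beta> x l = 0}"
  proof (rule subspace_eq_dimI)
    show sub: "vec.subspace {x \<in> W. \<beta> x l = 0}" by (rule left_perp(1)[OF W(1)])
    show "vec.span {r, l} \<subseteq> {x \<in> W. \<beta> x l = 0}"
      using rW l rl by (intro vec.span_minimal sub) (auto simp: left_radical_def)
    show "vec.dim (vec.span {r, l}) = vec.dim {x \<in> W. \<beta> x l = 0}"
      using left_perp(3)[OF W(1) t] W(2) d2 by simp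
  qed simp
  ultimately show ?thesis using x by blast
qed

text \<open>
Splitting off one chain \<open>J_2\<close> leaves a three-dimensional form of corank one, in which either a second \<open>J_2\<close> splits
off next to \<open>F_1\<close>, or the radicals are orthogonal and the whole complement is a chain \<open>J_3\<close>.
\<close>

lemma corank_two:
  assumes dim: "vec.dim (UNIV :: ('a^'n) set) = 5"
    and meet: "right_radical UNIV \<inter> left_radical UNIV = {0}" and dimR: "vec.dim (right_radical UNIV) = 2"
  shows "adapted graph_J2_J2_F1 \<or> adapted graph_J3_J2"
proof -
  let ?R = "right_radical UNIV" and ?L = "left_radical UNIV"
  have R: "vec.subspace ?R" and L: "vec.subspace ?L"
    by (simp_all add: subspace_right_radical subspace_left_radical)
  have dimL: "vec.dim ?L = 2" using dim_radicals_eq[OF vec.subspace_UNIV] dimR by simp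
  obtain r l where r: "r \<in> ?R" and l: "l \<in> ?L" and rl: "\<beta> r l = 1"
    using corank_two_radicals_not_orthogonal[OF assms] path2_if_radicals_not_orthogonal vec.subspace_UNIV by blast
  define W where "W = {x \<in> UNIV. \<beta> r x = 0 \<and> \<beta> x l = 0}"
  note W = split_path2[OF vec.subspace_UNIV r l rl W_def]
  have dimW: "vec.dim W = 3" using W(2) dim by simp
  have ne: "\<beta> r l \<noteq> 0" using rl by simp
  have "right_radical W = {x \<in> ?R. \<beta> x l = 0}" using W(4) by (auto simp: W_def right_radical_def)
  then have "vec.dim (right_radical W) = 1" using left_perp(3)[OF R r ne] dimR by simp
  then obtain r' where r': "right_radical W = vec.span {r'}" "r' \<noteq> 0"
    using dim_1_imp_span_singleton[OF subspace_right_radical[OF W(1)]] by blast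
  have "left_radical W = {x \<in> ?L. \<beta> r x = 0}" using W(5) by (auto simp: W_def left_radical_def)
  then have "vec.dim (left_radical W) = 1" using right_perp(3)[OF L l ne] dimL by simp
  then obtain l' where l': "left_radical W = vec.span {l'}" "l' \<noteq> 0"
    using dim_1_imp_span_singleton[OF subspace_left_radical[OF W(1)]] by blast
  have r'R: "r' \<in> right_radical W" and l'L: "l' \<in> left_radical W" by (simp_all add: r' l' vec.span_base)
  have r'L: "r' \<notin> left_radical W" and l'R: "l' \<notin> right_radical W"
    using r'R l'L r'(2) l'(2) meet W(4,5) by auto
  have outer: "\<beta> r w = 0" "\<beta> w r = 0" "\<beta> l w = 0" "\<beta> w l = 0" if "w \<in> W" for w
    using that r l by (auto simp: W_def right_radical_def left_radical_def)
  have outer': "\<beta> r r = 0" "\<beta> l l = 0" "\<beta> l r = 0" using r l by (auto simp: right_radical_def left_radical_def)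
  show ?thesis
  proof (cases "\<beta> r' l' = 0")
    case False
    obtain m where m: "m \<in> left_radical W" "\<beta> r' m = 1"
      using path2_if_radicals_not_orthogonal[OF r'R l'L False W(1)] by blast
    define Z where "Z = {x \<in> W. \<beta> r' x = 0 \<and> \<beta> x m = 0}"
    note Z = split_path2[OF W(1) r'R m Z_def]
    have radZ: "right_radical Z = {0}"
      by (rule right_radical_line_meets_split[OF r'(1) Z(4,1), of m]) (auto simp: m Z_def)
    obtain c where c: "vec.span {c} = Z" "\<beta> c c = 1"
      using unit_vector[OF Z(1) radZ] Z(2) dimW by auto
    have "c \<in> Z" using c(1) vec.span_base by blast
    then have cW: "c \<in> W" "\<beta> r' c = 0" "\<beta> c m = 0" by (auto simp: Z_def)
    have mW: "m \<in> W" "r' \<in> W" using m(1) r'R by (auto simp: left_radical_def right_radical_def)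
    have "gram [r, r', c, m, l] = pattern graph_J2_J2_F1"
      using outer[OF cW(1)] outer[OF mW(1)] outer[OF mW(2)] outer' rl m r'R c(2) cW mW
      by (simp add: gram_def pattern_def graph_defs right_radical_def left_radical_def)
    moreover have "vec.span {r, r', c, m, l} = UNIV"
      using W(3)[OF Z(3)[OF c(1)]] by (simp add: insert_commute)
    ultimately show ?thesis by (intro disjI1 adaptedI)
  next
    case True
    note perp = corank_one_dim_three_perps_equal[OF W(1) dimW r'R r'L l'L l'R True]
    obtain v m k where m: "m \<in> left_radical W" and v: "v \<in> W" "\<beta> v v = 0" "\<beta> r' v = 1" "\<beta> v m = 1"
      and k: "k \<noteq> 0" "m = k *s l'"
      using path3_if_perps_equal[OF W(1) r'R r'L l'L perp] by blast
    have perp': "\<beta> r' x = 0 \<longleftrightarrow> \<beta> x m = 0" if "x \<in> W" for x using perp[OF that] k by (simp add: expand)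
    have rm: "\<beta> r' m = 0" using True by (simp add: k expand)
    define Z where "Z = {x \<in> W. \<beta> r' x = 0 \<and> \<beta> v x = 0 \<and> \<beta> x v = 0}"
    note Z = split_path3[OF W(1) r'R m v perp' rm Z_def]
    have "vec.dim Z = 0" using Z(2) dimW by simp
    then have "Z \<subseteq> {0}" by (simp only: vec.dim_eq_0)
    then have "vec.span {} = Z" using vec.subspace_0[OF Z(1)] by auto
    then have "vec.span {r', v, m} = W" by (rule Z(3)[rotated])
    note span = W(3)[OF this]
    have mW: "m \<in> W" "r' \<in> W" using m(1) r'R by (auto simp: left_radical_def right_radical_def)
    have "gram [r, v, r', m, l] = pattern graph_J3_J2"
      using outer[OF v(1)] outer[OF mW(1)] outer[OF mW(2)] outer' rl m r'R v mW rm
      by (simp add: gram_def pattern_def graph_defs right_radical_def left_radical_def)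
    moreover have "vec.span {r, v, r', m, l} = UNIV"
      using span by (simp add: insert_commute)
    ultimately show ?thesis by (intro disjI2 adaptedI)
  qed
qed

text \<open>
Choose \<open>v2\<close>, \<open>v3\<close> with \<open>\<beta> r v2 = 1\<close>, \<open>\<beta> v2 l = 0\<close> and \<open>\<beta> r v3 = 0\<close>, \<open>\<beta> v3 l = 1\<close>, and \<open>u'\<close> completing \<open>r\<close>, \<open>l\<close> to a basis of
the intersection of the two hyperplanes. All remaining unwanted values are removed by adding multiples of
other basis vectors: \<open>r\<close> changes only products with \<open>v2\<close> on the right, \<open>l\<close> changes
only products with \<open>v3\<close> on the left. What survives is \<open>\<beta> u' u'\<close>. If it is nonzero,
the vector \<open>u\<close> splits off and the chain is \<open>r, v2, v3, l\<close>; if it is zero, nondegeneracy modulo the radicals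
forces the chain \<open>r, v2, u, v3, l\<close>.
\<close>

lemma corank_one_perps_differ:
  assumes dim: "vec.dim (UNIV :: ('a^'n) set) = 5"
    and R: "right_radical UNIV = vec.span {r}" and L: "left_radical UNIV = vec.span {l}"
    and r_l: "r \<notin> vec.span {l}" "l \<noteq> 0" and rl: "\<beta> r l = 0" and differ: "\<not> (\<forall>x. \<beta> r x = 0 \<longleftrightarrow> \<beta> x l = 0)"
  shows "adapted graph_J4_F1 \<or> adapted graph_J5"
proof -
  have r0 [simp]: "\<beta> x r = 0" for x
    using R vec.span_base[of r "{r}"] by (auto simp: right_radical_def)
  have l0 [simp]: "\<beta> l x = 0" for x
    using L vec.span_base[of l "{l}"] by (auto simp: left_radical_def)
  note rl [simp]
  have rR: "y \<in> vec.span {r, l}" if "\<And>x. \<beta> x y = 0" for y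
    using that R vec.span_mono[of "{r}" "{r, l}"] by (auto simp: right_radical_def)
  have lL: "y \<in> vec.span {l}" if "\<And>x. \<beta> y x = 0" for y
    using that L by (auto simp: left_radical_def)
  have lL': "y \<in> vec.span {r, l}" if "\<And>x. \<beta> y x = 0" for y
    using lL[OF that] vec.span_mono[of "{l}" "{r, l}"] by blast
  have "r \<noteq> 0" using r_l vec.span_zero by auto
  have "l \<notin> vec.span {r}"
  proof
    assume "l \<in> vec.span {r}"
    then obtain c where c: "l = c *s r" by (auto simp: vec.span_singleton)
    then have "r = inverse c *s l" using r_l(2) by auto
    then show False using r_l(1) by (metis insertI1 vec.span_base vec.span_scale)
  qed
  obtain y where y: "\<beta> r y \<noteq> 0" using lL[of r] r_l by blast
  obtain z where z: "\<beta> z l \<noteq> 0"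
    using R \<open>l \<notin> vec.span {r}\<close> by (auto simp: right_radical_def)
  define H where "H = {x \<in> UNIV. \<beta> r x = 0}"
  define K where "K = {x \<in> UNIV. \<beta> x l = 0}"
  have H: "vec.subspace H" "vec.dim H = 4"
    using right_perp(1)[OF vec.subspace_UNIV, of r, folded H_def]
      right_perp(3)[OF vec.subspace_UNIV UNIV_I y, folded H_def] dim by simp_all
  have K: "vec.subspace K" "vec.dim K = 4"
    using left_perp(1)[OF vec.subspace_UNIV, of l, folded K_def]
      left_perp(3)[OF vec.subspace_UNIV UNIV_I z, folded K_def] dim by simp_all
  have "\<not> H \<subseteq> K" "\<not> K \<subseteq> H"
    using subspace_eq_dimI[of H K] subspace_eq_dimI[of K H] H K differ by (auto simp: H_def K_def)
  then obtain v2' v3' where v2': "\<beta> v2' l = 0" "\<beta> r v2' \<noteq> 0" and v3': "\<beta> r v3' = 0" "\<beta> v3' l \<noteq> 0"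
    by (auto simp: H_def K_def)
  define v2 where "v2 = inverse (\<beta> r v2') *s v2'"
  have v2 [simp]: "\<beta> v2 l = 0" "\<beta> r v2 = 1" using v2' by (simp_all add: v2_def expand)
  obtain e where e: "e ^ q = inverse (\<beta> v3' l)" using \<sigma>_surj by blast
  define v3 where "v3 = e *s v3'"
  have v3 [simp]: "\<beta> r v3 = 0" "\<beta> v3 l = 1" using v3' e by (simp_all add: v3_def expand)
  define U where "U = {x \<in> H. \<beta> x l = 0}"
  have v3H: "v3 \<in> H" by (simp add: H_def)
  have U: "vec.subspace U" "vec.dim U = 3"
    using left_perp(1)[OF H(1), of l, folded U_def] left_perp(3)[OF H(1) v3H, of l, folded U_def] H(2) by simp_all
  have rlU: "{r, l} \<subseteq> U" by (simp add: U_def H_def)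
  have d2: "vec.dim {r, l} = 2" using r_l by (simp add: vec.dim_insert)
  have span: "vec.span {a, b, u, r, l} = UNIV"
    if "\<beta> r a = 1" "\<beta> r b = 0" "\<beta> b l = 1" "u \<in> U" "u \<notin> vec.span {r, l}" for a b u
  proof -
    have "vec.dim {u, r, l} = 3" using d2 that by (simp add: vec.dim_insert)
    then have "vec.span {u, r, l} = U"
      using U rlU that vec.dim_span[of "{u, r, l}"] by (intro subspace_eq_dimI vec.span_minimal) auto
    then have "vec.span {b, u, r, l} = vec.span (insert b U)" by (rule span_insert_cong)
    also have "\<dots> = H" using left_perp(2)[OF H(1), of b l] that unfolding U_def by (simp add: H_def)
    finally have "vec.span {a, b, u, r, l} = vec.span (insert a H)" by (rule span_insert_cong)
    also have "\<dots> = UNIV" using right_perp(2)[OF vec.subspace_UNIV, of a r] that unfolding H_def by simp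
    finally show ?thesis .
  qed
  obtain u' where u': "u' \<in> U" "u' \<notin> vec.span {r, l}"
  proof (rule ccontr)
    assume "\<not> thesis"
    then have "U \<subseteq> vec.span {r, l}" using that by blast
    then have "vec.dim U \<le> 2" using vec.dim_mono d2 by metis
    then show False using U by simp
  qed
  have u'0 [simp]: "\<beta> r u' = 0" "\<beta> u' l = 0" using u'(1) by (auto simp: U_def H_def)
  have shift: "e *s u' - (s *s r + t *s l) \<in> U" "e *s u' - (s *s r + t *s l) \<notin> vec.span {r, l}" if "e \<noteq> 0" for e s t
  proof -
    show "e *s u' - (s *s r + t *s l) \<in> U"
      using U(1) u'(1) rlU by (intro vec.subspace_diff vec.subspace_add vec.subspace_scale) auto
    have "s *s r + t *s l \<in> vec.span {r, l}"
      by (intro vec.span_add vec.span_scale vec.span_base) auto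
    moreover have "e *s u' \<notin> vec.span {r, l}"
      using u'(2) that vec.span_scale[of "e *s u'" "{r, l}" "inverse e"] by auto
    ultimately show "e *s u' - (s *s r + t *s l) \<notin> vec.span {r, l}"
      using vec.span_add[of "e *s u' - (s *s r + t *s l)" "{r, l}" "s *s r + t *s l"] by auto
  qed
  show ?thesis
  proof (cases "\<beta> u' u' = 0")
    case False
    obtain e where e: "e ^ (q + 1) = inverse (\<beta> u' u')"
      using nth_root_exists[of "q + 1" "inverse (\<beta> u' u')"] by auto
    have "e \<noteq> 0" using e False by auto
    have uu: "\<beta> (e *s u') (e *s u') = 1"
    proof -
      have "\<beta> (e *s u') (e *s u') = e ^ (q + 1) * \<beta> u' u'" by (simp add: expand)
      then show ?thesis using e False by simp
    qed
    define u where "u = e *s u'"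
    have u0 [simp]: "\<beta> r u = 0" "\<beta> u l = 0" "\<beta> u u = 1" using uu by (simp_all add: u_def expand)
    (* Multiples of u first make v2 and v3 one-sidedly orthogonal to u, then multiples of r and l
       added to u give orthogonality on the other side without spoiling the former. *)
    obtain c1 where c1: "c1 ^ q = \<beta> v2 u" using \<sigma>_surj by blast
    define a2 where "a2 = v2 - c1 *s u"
    define a3 where "a3 = v3 - \<beta> u v3 *s u"
    have a2 [simp]: "\<beta> a2 u = 0" "\<beta> r a2 = 1" "\<beta> a2 l = 0" by (simp_all add: a2_def expand c1)
    have a3 [simp]: "\<beta> u a3 = 0" "\<beta> r a3 = 0" "\<beta> a3 l = 1" by (simp_all add: a3_def expand)
    obtain s where s: "s ^ q = \<beta> u a2" using \<sigma>_surj by blast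
    define w where "w = u - (s *s r + \<beta> a3 u *s l)"
    have w [simp]: "\<beta> r w = 0" "\<beta> w l = 0" "\<beta> w w = 1" "\<beta> w a2 = 0" "\<beta> a3 w = 0" "\<beta> a2 w = 0" "\<beta> w a3 = 0"
      by (simp_all add: w_def expand s)
    have wU: "w \<in> U" "w \<notin> vec.span {r, l}" using shift[OF \<open>e \<noteq> 0\<close>] by (simp_all add: w_def u_def)
    obtain a where a: "a ^ q = \<beta> a2 a2" using \<sigma>_surj by blast
    define b2 where "b2 = a2 - a *s r - \<beta> a3 a2 *s l"
    define b3 where "b3 = a3 - \<beta> a3 a3 *s l"
    have b3 [simp]: "\<beta> r b3 = 0" "\<beta> b3 l = 1" "\<beta> b3 b3 = 0" "\<beta> b3 w = 0" "\<beta> w b3 = 0"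
      by (simp_all add: b3_def expand)
    have b2 [simp]: "\<beta> r b2 = 1" "\<beta> b2 l = 0" "\<beta> b2 b2 = 0" "\<beta> b2 w = 0" "\<beta> w b2 = 0" "\<beta> b3 b2 = 0"
      by (simp_all add: b2_def b3_def expand a)
    have all: "vec.span {b2, b3, w, r, l} = UNIV" by (rule span) (simp_all add: wU)
    have "\<beta> b2 b3 \<noteq> 0"
    proof
      assume d: "\<beta> b2 b3 = 0"
      have "\<beta> b2 x = 0" for x
        by (rule right_zero_on_span[of "{b2, b3, w, r, l}"]) (auto simp: all d)
      then have "b2 \<in> vec.span {l}" by (rule lL)
      then obtain c where c: "b2 = c *s l" by (auto simp: vec.span_singleton)
      have "\<beta> r b2 = 0" unfolding c by (simp add: expand)
      then show False by simp
    qed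
    obtain k where k: "k ^ q = inverse (\<beta> b2 b3)" using \<sigma>_surj by blast
    obtain m where m: "m ^ q = inverse k" using \<sigma>_surj by blast
    have km: "k \<noteq> 0" "m \<noteq> 0" using k m \<open>\<beta> b2 b3 \<noteq> 0\<close> q_gt_1 by auto
    have "gram [b3, m *s r, w, k *s b2, l] = pattern graph_J4_F1"
      using k m km \<open>\<beta> b2 b3 \<noteq> 0\<close> by (simp add: gram_def pattern_def graph_defs expand)
    moreover have "vec.span {b3, m *s r, w, k *s b2, l} = UNIV"
    proof -
      have "{b3, m *s r, w, k *s b2, l} = {m *s r, k *s b2, b3, w, l}" by blast
      also have "vec.span \<dots> = vec.span {r, k *s b2, b3, w, l}" by (rule span_insert_scale[OF km(2)])
      also have "{r, k *s b2, b3, w, l} = {k *s b2, r, b3, w, l}" by blast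
      also have "vec.span \<dots> = vec.span {b2, r, b3, w, l}" by (rule span_insert_scale[OF km(1)])
      also have "{b2, r, b3, w, l} = {b2, b3, w, r, l}" by blast
      finally show ?thesis using all by simp
    qed
    ultimately show ?thesis by (intro disjI1 adaptedI)
  next
    case True
    obtain s where s: "s ^ q = \<beta> u' v2" using \<sigma>_surj by blast
    define u where "u = u' - (s *s r + \<beta> v3 u' *s l)"
    have u [simp]: "\<beta> r u = 0" "\<beta> u l = 0" "\<beta> u u = 0" "\<beta> u v2 = 0" "\<beta> v3 u = 0"
      by (simp_all add: u_def expand s True)
    have uU: "u \<in> U" "u \<notin> vec.span {r, l}" using shift[of 1] by (simp_all add: u_def)
    have all0: "vec.span {v2, v3, u, r, l} = UNIV" by (rule span) (simp_all add: uU)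
    have n1: "\<beta> v2 u \<noteq> 0"
    proof
      assume d: "\<beta> v2 u = 0"
      have "\<beta> x u = 0" for x
        by (rule left_zero_on_span[of "{v2, v3, u, r, l}"]) (auto simp: all0 d)
      then show False using rR uU by blast
    qed
    have n2: "\<beta> u v3 \<noteq> 0"
    proof
      assume d: "\<beta> u v3 = 0"
      have "\<beta> u x = 0" for x
        by (rule right_zero_on_span[of "{v2, v3, u, r, l}"]) (auto simp: all0 d)
      then show False using lL' uU by blast
    qed
    (* Since u now pairs with v3, a multiple of u removes the value at v2, v3. *)
    obtain c1 where c1: "c1 ^ q = \<beta> v2 v3 / \<beta> u v3" using \<sigma>_surj by blast
    define a2 where "a2 = v2 - c1 *s u"
    have a2 [simp]: "\<beta> a2 v3 = 0" "\<beta> a2 u = \<beta> v2 u" "\<beta> u a2 = 0" "\<beta> r a2 = 1" "\<beta> a2 l = 0"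
      using n2 by (simp_all add: a2_def expand c1)
    obtain a where a: "a ^ q = \<beta> a2 a2" using \<sigma>_surj by blast
    define b2 where "b2 = a2 - a *s r - \<beta> v3 a2 *s l"
    define b3 where "b3 = v3 - \<beta> v3 v3 *s l"
    have b3 [simp]: "\<beta> r b3 = 0" "\<beta> b3 l = 1" "\<beta> b3 b3 = 0" "\<beta> b3 u = 0" "\<beta> u b3 = \<beta> u v3"
      by (simp_all add: b3_def expand)
    have b2 [simp]: "\<beta> r b2 = 1" "\<beta> b2 l = 0" "\<beta> b2 b2 = 0" "\<beta> b2 u = \<beta> v2 u" "\<beta> u b2 = 0" "\<beta> b3 b2 = 0" "\<beta> b2 b3 = 0"
      by (simp_all add: b2_def b3_def expand a)
    have all: "vec.span {b2, b3, u, r, l} = UNIV" by (rule span) (simp_all add: uU)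
    (* Rescale along the chain, starting from b2, so that each link gets the value 1. *)
    define k where "k = inverse (\<beta> v2 u)"
    define m where "m = inverse (k ^ q * \<beta> u v3)"
    define n where "n = inverse (m ^ q)"
    have kmn: "k \<noteq> 0" "m \<noteq> 0" "n \<noteq> 0" using n1 n2 by (simp_all add: k_def m_def n_def)
    have "k * \<beta> v2 u = 1" using n1 by (simp add: k_def)
    moreover have "k ^ q * (m * \<beta> u v3) = 1" using n2 kmn(1) by (simp add: m_def field_simps)
    moreover have "m ^ q * n = 1" using kmn(2) by (simp add: n_def)
    ultimately have "gram [m *s b3, b2, r, k *s u, n *s l] = pattern graph_J5"
      by (simp add: gram_def pattern_def graph_defs expand mult_ac)
    moreover have "vec.span {m *s b3, b2, r, k *s u, n *s l} = UNIV"
    proof -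
      have "{m *s b3, b2, r, k *s u, n *s l} = {k *s u, m *s b3, n *s l, b2, r}" by blast
      also have "vec.span \<dots> = vec.span {u, m *s b3, n *s l, b2, r}" by (rule span_insert_scale[OF kmn(1)])
      also have "{u, m *s b3, n *s l, b2, r} = {m *s b3, n *s l, u, b2, r}" by blast
      also have "vec.span \<dots> = vec.span {b3, n *s l, u, b2, r}" by (rule span_insert_scale[OF kmn(2)])
      also have "{b3, n *s l, u, b2, r} = {n *s l, b2, b3, u, r}" by blast
      also have "vec.span \<dots> = vec.span {l, b2, b3, u, r}" by (rule span_insert_scale[OF kmn(3)])
      also have "{l, b2, b3, u, r} = {b2, b3, u, r, l}" by blast
      finally show ?thesis using all by simp
    qed
    ultimately show ?thesis by (intro disjI2 adaptedI)
  qed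
qed

text \<open>
Disjointness of the radicals bounds their common dimension by \<open>5 / 2\<close>; the cases \<open>0\<close>, \<open>1\<close>, \<open>2\<close> are those
treated above.
\<close>

theorem normal_form:
  assumes dim: "vec.dim (UNIV :: ('a^'n) set) = 5"
    and meet: "right_radical UNIV \<inter> left_radical UNIV = {0}"
  shows "\<exists>E \<in> set quinary_graphs. adapted E"
proof -
  let ?R = "right_radical UNIV" and ?L = "left_radical UNIV"
  have R: "vec.subspace ?R" and L: "vec.subspace ?L"
    by (simp_all add: subspace_right_radical subspace_left_radical)
  have dimL: "vec.dim ?L = vec.dim ?R" by (rule dim_radicals_eq) simp
  have "2 * vec.dim ?R = vec.dim {x + y |x y. x \<in> ?R \<and> y \<in> ?L}"
    using vec.dim_sums_Int[OF R L] meet dimL by simp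
  also have "\<dots> \<le> 5" unfolding dim[symmetric] by (rule vec.dim_subset) simp
  finally consider "vec.dim ?R = 0" | "vec.dim ?R = 1" | "vec.dim ?R = 2" by linarith
  then show ?thesis
  proof cases
    case 1
    then have "?R \<subseteq> {0}" by (simp only: vec.dim_eq_0)
    then have "?R = {0}" using vec.subspace_0[OF R] by blast
    then show ?thesis using adapted_nondegenerate[OF dim] by (simp add: quinary_graphs_def)
  next
    case 2
    then obtain r where r: "?R = vec.span {r}" "r \<noteq> 0" using dim_1_imp_span_singleton[OF R] by blast
    from 2 dimL obtain l where l: "?L = vec.span {l}" "l \<noteq> 0" using dim_1_imp_span_singleton[OF L] by metis
    have lL: "l \<in> ?L" and rR: "r \<in> ?R" by (simp_all add: l r vec.span_base)
    have rL: "r \<notin> ?L" using meet rR r(2) by blast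
    show ?thesis
    proof (cases "\<beta> r l = 0")
      case False
      then show ?thesis using corank_one_not_orthogonal[OF dim r(1) lL] by (simp add: quinary_graphs_def)
    next
      case True
      show ?thesis
      proof (cases "\<forall>x. \<beta> r x = 0 \<longleftrightarrow> \<beta> x l = 0")
        case perp: True
        have "adapted graph_J3_F2"
          by (rule corank_one_perps_equal[OF dim r(1) lL True rL perp[rule_format]])
        then show ?thesis by (simp add: quinary_graphs_def)
      next
        case False
        have "adapted graph_J4_F1 \<or> adapted graph_J5"
          using corank_one_perps_differ[OF dim r(1) l(1) rL[unfolded l(1)] l(2) True False] .
        then show ?thesis by (auto simp: quinary_graphs_def)
      qed
    qed
  next
    case 3
    then show ?thesis using corank_two[OF dim meet] by (auto simp: quinary_graphs_def)
  qed
qed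

end

section \<open>Frobenius forms and their matrices\<close>

definition bform :: "nat \<Rightarrow> 'a::comm_semiring_1^'n^'n \<Rightarrow> 'a^'n \<Rightarrow> 'a^'n \<Rightarrow> 'a" where
  "bform q A x y = (\<Sum>i\<in>UNIV. \<Sum>j\<in>UNIV. x $ i ^ q * A $ i $ j * y $ j)"

definition congr :: "nat \<Rightarrow> 'a::comm_semiring_1^'n^'n \<Rightarrow> 'a^'n^'n \<Rightarrow> 'a^'n^'n" where
  "congr q g A = (\<chi> k l. \<Sum>i\<in>UNIV. \<Sum>j\<in>UNIV. g $ i $ k ^ q * A $ i $ j * g $ j $ l)"

definition frob_poly :: "nat \<Rightarrow> 'a::field^'n^'n \<Rightarrow> ('n, 'a) mpoly" where
  "frob_poly q A = (\<Sum>i\<in>UNIV. \<Sum>j\<in>UNIV. var i ^ q * const (A $ i $ j) * var j)"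

lemma const_0 [simp]: "const 0 = 0" by (simp add: const_def)
lemma const_1 [simp]: "const 1 = 1" by (simp add: const_def)
lemma const_add: "const (a + b) = const a + const b" by (simp add: const_def single_add)
lemma const_mult: "const (a * b) = const a * const b" by (simp add: const_def mult_single)
lemma const_sum: "const (\<Sum>i\<in>I. f i) = (\<Sum>i\<in>I. const (f i))"
  by (induction I rule: infinite_finite_induct) (auto simp: const_add)
lemma const_power: "const (a ^ k) = const a ^ k"
  by (induction k) (auto simp: const_mult)

lemma var_power: "var i ^ k = Poly_Mapping.single (Poly_Mapping.single i k) 1"
  by (induction k) (auto simp: var_def mult_single single_add[symmetric])

abbreviation mon :: "nat \<Rightarrow> 'n \<Rightarrow> 'n \<Rightarrow> 'n \<Rightarrow>\<^sub>0 nat" where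
  "mon q i j \<equiv> Poly_Mapping.single i q + Poly_Mapping.single j 1"

lemma frobenius_term: "var i ^ q * const c * var j = Poly_Mapping.single (mon q i j) c"
  unfolding var_power by (simp add: const_def var_def mult_single)

lemma frob_poly_singles: "frob_poly q A = (\<Sum>i\<in>UNIV. \<Sum>j\<in>UNIV. Poly_Mapping.single (mon q i j) (A $ i $ j))"
  by (simp add: frob_poly_def frobenius_term)

text \<open>
For \<open>q \<ge> 2\<close> the exponent vector remembers which variable carries the \<open>q\<close>-th power; for \<open>q = 1\<close> the two
indices could be exchanged.
\<close>

lemma mon_inject:
  assumes "q \<ge> 2" "mon q i j = mon q k l"
  shows "i = k \<and> j = l"
proof -
  have "Poly_Mapping.lookup (mon q i j) i = Poly_Mapping.lookup (mon q k l) i" using assms(2) by simp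
  then have ik: "i = k" using assms(1) by (cases "k = i"; cases "l = i") (auto simp: lookup_add lookup_single when_def)
  then have "Poly_Mapping.single j (1::nat) = Poly_Mapping.single l 1" using assms(2) by (metis add_left_cancel)
  then have "Poly_Mapping.lookup (Poly_Mapping.single j (1::nat)) j = Poly_Mapping.lookup (Poly_Mapping.single l 1) j" by simp
  then have "j = l" by (simp add: lookup_single when_def split: if_splits)
  then show ?thesis using ik by simp
qed

lemma mon_eq_iff: "q \<ge> 2 \<Longrightarrow> mon q i j = mon q k l \<longleftrightarrow> i = k \<and> j = l"
  using mon_inject by metis

lemma lookup_frob_poly:
  assumes "q \<ge> 2"
  shows "Poly_Mapping.lookup (frob_poly q A) (mon q k l) = A $ k $ l"
proof -
  have "Poly_Mapping.lookup (frob_poly q A) (mon q k l) =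
      (\<Sum>i\<in>UNIV. \<Sum>j\<in>UNIV. if i = k \<and> j = l then A $ i $ j else 0)"
    unfolding frob_poly_singles lookup_sum lookup_single when_def mon_eq_iff[OF assms] ..
  also have "\<dots> = (\<Sum>i\<in>UNIV. if i = k then A $ i $ l else 0)"
    by (intro sum.cong refl) auto
  finally show ?thesis by simp
qed

lemma frob_poly_inject: "q \<ge> 2 \<Longrightarrow> frob_poly q A = frob_poly q B \<longleftrightarrow> A = B"
  by (metis (no_types, lifting) lookup_frob_poly vec_eq_iff)

lemma frobenius_form_iff: "frobenius_form q h \<longleftrightarrow> (\<exists>A. h = frob_poly q A)"
proof
  assume "frobenius_form q h"
  then obtain L where L: "\<And>i. linear_form (L i)" "h = (\<Sum>i\<in>UNIV. var i ^ q * L i)"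
    by (auto simp: frobenius_form_def)
  then obtain c where "\<And>i. L i = (\<Sum>j\<in>UNIV. const (c i j) * var j)"
    unfolding linear_form_def by metis
  then have "h = frob_poly q (\<chi> i j. c i j)"
    by (simp add: L(2) frob_poly_def sum_distrib_left mult.assoc)
  then show "\<exists>A. h = frob_poly q A" ..
next
  assume "\<exists>A. h = frob_poly q A"
  then obtain A where "h = frob_poly q A" ..
  then have "h = (\<Sum>i\<in>UNIV. var i ^ q * (\<Sum>j\<in>UNIV. const (A $ i $ j) * var j))"
    by (simp add: frob_poly_def sum_distrib_left mult.assoc)
  then show "frobenius_form q h"
    unfolding frobenius_form_def linear_form_def
    by (intro exI[of _ "\<lambda>i. \<Sum>j\<in>UNIV. const (A $ i $ j) * var j"]) auto
qed

lemma frobenius_matrix_frob_poly: "q \<ge> 2 \<Longrightarrow> frobenius_matrix q (frob_poly q A) = A"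
  unfolding frobenius_matrix_def frob_poly_def[symmetric] by (auto simp: frob_poly_inject)

lemma vars_frob_poly:
  assumes "q \<ge> 2"
  shows "k \<notin> vars (frob_poly q A) \<longleftrightarrow> (\<forall>i. A $ i $ k = 0 \<and> A $ k $ i = 0)"
proof
  assume k: "k \<notin> vars (frob_poly q A)"
  have "A $ i $ j = 0" if "i = k \<or> j = k" for i j
  proof (rule ccontr)
    assume "A $ i $ j \<noteq> 0"
    then have "mon q i j \<in> Poly_Mapping.keys (frob_poly q A)"
      by (simp add: in_keys_iff lookup_frob_poly[OF assms] del: One_nat_def)
    moreover have "k \<in> Poly_Mapping.keys (mon q i j)"
      using that assms by (auto simp: in_keys_iff lookup_add lookup_single)
    ultimately show False using k by (auto simp: vars_def)
  qed
  then show "\<forall>i. A $ i $ k = 0 \<and> A $ k $ i = 0" by blast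
next
  assume A: "\<forall>i. A $ i $ k = 0 \<and> A $ k $ i = 0"
  show "k \<notin> vars (frob_poly q A)"
  proof
    assume "k \<in> vars (frob_poly q A)"
    then obtain m where m: "Poly_Mapping.lookup (frob_poly q A) m \<noteq> 0" "k \<in> Poly_Mapping.keys m"
      by (auto simp: vars_def in_keys_iff)
    from m(1) have "\<exists>i j. (A $ i $ j when mon q i j = m) \<noteq> 0"
      unfolding frob_poly_singles lookup_sum lookup_single by (meson sum.not_neutral_contains_not_neutral)
    then obtain i j where ij: "mon q i j = m" "A $ i $ j \<noteq> 0" by (auto simp: when_def split: if_splits)
    have "i = k \<or> j = k" using m(2) unfolding ij(1)[symmetric]
      by (auto simp: in_keys_iff lookup_add lookup_single when_def split: if_splits)
    then show False using A ij(2) by auto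
  qed
qed

lemma subst_vars_superset:
  assumes "finite S" "Poly_Mapping.keys h \<subseteq> S"
  shows "subst_vars f h = (\<Sum>m\<in>S. const (Poly_Mapping.lookup h m) * (\<Prod>i\<in>UNIV. f i ^ Poly_Mapping.lookup m i))"
  unfolding subst_vars_def using assms by (intro sum.mono_neutral_left) (auto simp: in_keys_iff)

lemma subst_vars_add: "subst_vars f (h + h') = subst_vars f h + subst_vars f h'"
proof -
  let ?S = "Poly_Mapping.keys h \<union> Poly_Mapping.keys h'"
  show ?thesis
    using subst_vars_superset[of ?S h f] subst_vars_superset[of ?S h' f] subst_vars_superset[of ?S "h + h'" f]
      Poly_Mapping.keys_add[of h h']
    by (simp add: lookup_add const_add distrib_right sum.distrib)
qed

lemma subst_vars_sum: "subst_vars f (\<Sum>i\<in>I. h i) = (\<Sum>i\<in>I. subst_vars f (h i))"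
proof (induction I rule: infinite_finite_induct)
qed (auto simp: subst_vars_add, auto simp: subst_vars_def)

lemma subst_vars_mon: "subst_vars f (Poly_Mapping.single (mon q i j) c) = const c * (f i ^ q * f j)"
proof -
  have "subst_vars f (Poly_Mapping.single (mon q i j) c) = const c * (\<Prod>k\<in>UNIV. f k ^ Poly_Mapping.lookup (mon q i j) k)"
    using subst_vars_superset[of "{mon q i j}" "Poly_Mapping.single (mon q i j) c" f] by simp
  also have "(\<Prod>k\<in>UNIV. f k ^ Poly_Mapping.lookup (mon q i j) k) =
      (\<Prod>k\<in>UNIV. if k = i then f k ^ q else 1) * (\<Prod>k\<in>UNIV. if k = j then f k else 1)"
    unfolding prod.distrib[symmetric]
    by (intro prod.cong refl) (auto simp: lookup_add lookup_single when_def power_add)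
  finally show ?thesis by simp
qed

text \<open>
The coefficient field embeds in the polynomial ring, so the additivity of the \<open>q\<close>-th power also holds for
polynomials.
\<close>

lemma CHAR_mpoly: "CHAR(('n, 'a::comm_ring_1) mpoly) = CHAR('a)"
proof (rule CHAR_eqI)
  have of_nat: "of_nat k = (Poly_Mapping.single 0 (of_nat k) :: ('n, 'a) mpoly)" for k by simp
  show "of_nat CHAR('a) = (0 :: ('n, 'a) mpoly)" unfolding of_nat by simp
  show "CHAR('a) dvd k" if "of_nat k = (0 :: ('n, 'a) mpoly)" for k
  proof -
    have "(of_nat k :: 'a) = Poly_Mapping.lookup (of_nat k :: ('n, 'a) mpoly) 0"
      unfolding of_nat lookup_single_eq ..
    then have "(of_nat k :: 'a) = 0" using that by simp
    then show ?thesis by (simp only: of_nat_eq_0_iff_char_dvd)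
  qed
qed

text \<open>
The parameter of type \<open>itself\<close> fixes the coefficient field, which the two numbers do not determine.
\<close>

locale frobenius_power =
  fixes q e :: nat and field_type :: "'a::alg_closed_field itself"
  assumes prime_char: "prime CHAR('a)" and e_pos: "e \<ge> 1" and q_def: "q = CHAR('a) ^ e"
begin

lemma q_ge_2: "q \<ge> 2"
proof -
  have "CHAR('a) \<ge> 2" using prime_char by (rule prime_ge_2_nat)
  also have "CHAR('a) = CHAR('a) ^ 1" by simp
  also have "\<dots> \<le> CHAR('a) ^ e" using e_pos \<open>CHAR('a) \<ge> 2\<close> by (intro power_increasing) auto
  finally show ?thesis by (simp add: q_def)
qed

lemma power_q_sum: "(\<Sum>i\<in>I. f i :: 'a) ^ q = (\<Sum>i\<in>I. f i ^ q)"
  using prime_char q_def by (rule freshmans_dream_sum')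

lemma mpoly_power_q_sum: "(\<Sum>i\<in>I. f i :: ('n, 'a) mpoly) ^ q = (\<Sum>i\<in>I. f i ^ q)"
  by (rule freshmans_dream_sum') (simp_all add: CHAR_mpoly prime_char q_def)

text \<open>
In characteristic \<open>p\<close> the \<open>q\<close>-th power of a linear form is the sum of the \<open>q\<close>-th powers of its terms, so a
change of variables again yields a Frobenius form, with the expected matrix.
\<close>

lemma lin_change_frob_poly:
  fixes A :: "'a^'n^'n"
  shows "lin_change g (frob_poly q A) = frob_poly q (congr q g A)"
proof -
  have "lin_change g (frob_poly q A) =
    (\<Sum>i\<in>UNIV. \<Sum>j\<in>UNIV. const (A $ i $ j) * ((\<Sum>k\<in>UNIV. const (g $ i $ k) * var k) ^ q * (\<Sum>l\<in>UNIV. const (g $ j $ l) * var l)))"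
    by (simp only: lin_change_def frob_poly_singles subst_vars_sum subst_vars_mon)
  also have "\<dots> = (\<Sum>i\<in>UNIV. \<Sum>j\<in>UNIV. \<Sum>k\<in>UNIV. \<Sum>l\<in>UNIV.
      var k ^ q * const (g $ i $ k ^ q * A $ i $ j * g $ j $ l) * var l)"
    by (intro sum.cong refl)
       (simp add: mpoly_power_q_sum power_mult_distrib const_mult const_power sum_distrib_left sum_distrib_right mult_ac)
  also have "\<dots> = (\<Sum>i\<in>UNIV. \<Sum>k\<in>UNIV. \<Sum>j\<in>UNIV. \<Sum>l\<in>UNIV.
      var k ^ q * const (g $ i $ k ^ q * A $ i $ j * g $ j $ l) * var l)"
    by (intro sum.cong refl sum.swap)
  also have "\<dots> = (\<Sum>k\<in>UNIV. \<Sum>i\<in>UNIV. \<Sum>j\<in>UNIV. \<Sum>l\<in>UNIV.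
      var k ^ q * const (g $ i $ k ^ q * A $ i $ j * g $ j $ l) * var l)"
    by (rule sum.swap)
  also have "\<dots> = (\<Sum>k\<in>UNIV. \<Sum>i\<in>UNIV. \<Sum>l\<in>UNIV. \<Sum>j\<in>UNIV.
      var k ^ q * const (g $ i $ k ^ q * A $ i $ j * g $ j $ l) * var l)"
    by (intro sum.cong refl sum.swap)
  also have "\<dots> = (\<Sum>k\<in>UNIV. \<Sum>l\<in>UNIV. \<Sum>i\<in>UNIV. \<Sum>j\<in>UNIV.
      var k ^ q * const (g $ i $ k ^ q * A $ i $ j * g $ j $ l) * var l)"
    by (intro sum.cong refl sum.swap)
  also have "\<dots> = frob_poly q (congr q g A)"
    by (simp add: frob_poly_def congr_def const_sum sum_distrib_left sum_distrib_right)
  finally show ?thesis .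
qed

lemma bform_congr:
  fixes A :: "'a^'n^'n"
  shows "bform q (congr q g A) x y = bform q A (g *v x) (g *v y)"
proof -
  have "bform q A (g *v x) (g *v y) = (\<Sum>i\<in>UNIV. \<Sum>j\<in>UNIV. \<Sum>k\<in>UNIV. \<Sum>l\<in>UNIV.
      x $ k ^ q * (g $ i $ k ^ q * A $ i $ j * g $ j $ l) * y $ l)"
    unfolding bform_def matrix_vector_mult_def
    by (intro sum.cong refl)
       (simp add: power_q_sum power_mult_distrib sum_distrib_left sum_distrib_right mult_ac)
  also have "\<dots> = (\<Sum>i\<in>UNIV. \<Sum>k\<in>UNIV. \<Sum>j\<in>UNIV. \<Sum>l\<in>UNIV.
      x $ k ^ q * (g $ i $ k ^ q * A $ i $ j * g $ j $ l) * y $ l)"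
    by (intro sum.cong refl sum.swap)
  also have "\<dots> = (\<Sum>k\<in>UNIV. \<Sum>i\<in>UNIV. \<Sum>j\<in>UNIV. \<Sum>l\<in>UNIV.
      x $ k ^ q * (g $ i $ k ^ q * A $ i $ j * g $ j $ l) * y $ l)"
    by (rule sum.swap)
  also have "\<dots> = (\<Sum>k\<in>UNIV. \<Sum>i\<in>UNIV. \<Sum>l\<in>UNIV. \<Sum>j\<in>UNIV.
      x $ k ^ q * (g $ i $ k ^ q * A $ i $ j * g $ j $ l) * y $ l)"
    by (intro sum.cong refl sum.swap)
  also have "\<dots> = (\<Sum>k\<in>UNIV. \<Sum>l\<in>UNIV. \<Sum>i\<in>UNIV. \<Sum>j\<in>UNIV.
      x $ k ^ q * (g $ i $ k ^ q * A $ i $ j * g $ j $ l) * y $ l)"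
    by (intro sum.cong refl sum.swap)
  also have "\<dots> = bform q (congr q g A) x y"
    by (simp add: bform_def congr_def sum_distrib_left sum_distrib_right)
  finally show ?thesis by simp
qed

lemma frobenius_sesquilinear_bform: "frobenius_sesquilinear q (bform q (A :: 'a^'n^'n))"
proof unfold_locales
  show add: "(a + b) ^ q = a ^ q + b ^ q" for a b :: 'a
    using prime_char q_def by (rule freshmans_dream')
  show "(a * b) ^ q = a ^ q * b ^ q" for a b :: 'a by (rule power_mult_distrib)
  show "bij (\<lambda>a :: 'a. a ^ q)"
  proof (rule bijI)
    show "inj (\<lambda>a :: 'a. a ^ q)"
    proof (rule injI)
      fix a b :: 'a
      assume "a ^ q = b ^ q"
      then have "(a - b) ^ q = 0" using add[of "a - b" b] by simp
      then show "a = b" by simp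
    qed
    show "surj (\<lambda>a :: 'a. a ^ q)"
      using nth_root_exists[where ?'a = 'a] q_ge_2 by (metis (no_types) le_zero_eq not_gr_zero not_numeral_le_zero surjI)
  qed
  show "bform q A (x + y) z = bform q A x z + bform q A y z" for x y z
    by (simp add: bform_def add distrib_right sum.distrib)
  show "bform q A x (y + z) = bform q A x y + bform q A x z" for x y z
    by (simp add: bform_def distrib_left sum.distrib)
  show "bform q A (c *s x) y = c ^ q * bform q A x y" for c x y
    by (simp add: bform_def power_mult_distrib sum_distrib_left mult_ac)
  show "bform q A x (c *s y) = c * bform q A x y" for c x y
    by (simp add: bform_def sum_distrib_left mult_ac)
  show "q > 1" using q_ge_2 by simp
qed

lemma bform_axis:
  fixes A :: "'a^'n^'n"
  shows "bform q A (axis i 1) y = (\<Sum>j\<in>UNIV. A $ i $ j * y $ j)"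
    and "bform q A x (axis j 1) = (\<Sum>i\<in>UNIV. x $ i ^ q * A $ i $ j)"
    and "bform q A (axis i 1) (axis j 1) = A $ i $ j"
proof -
  have 1: "(axis i 1 :: 'a^'n) $ k ^ q = (if k = i then 1 else 0)" for i k
    using q_ge_2 by (simp add: axis_def power_0_left)
  have 2: "x * (axis j 1 :: 'a^'n) $ k = (if k = j then x else 0)" for j k x
    by (simp add: axis_def)
  have 3: "(if b then 1 else 0) * x = (if b then x else 0)" for b and x :: 'a by simp
  show *: "bform q A (axis i 1) y = (\<Sum>j\<in>UNIV. A $ i $ j * y $ j)" for y
  proof -
    have "bform q A (axis i 1) y = (\<Sum>k\<in>UNIV. if k = i then (\<Sum>j\<in>UNIV. A $ k $ j * y $ j) else 0)"
      unfolding bform_def 1 by (intro sum.cong refl) auto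
    then show ?thesis by simp
  qed
  show "bform q A x (axis j 1) = (\<Sum>i\<in>UNIV. x $ i ^ q * A $ i $ j)"
    unfolding bform_def 2 by simp
  show "bform q A (axis i 1) (axis j 1) = A $ i $ j"
    unfolding * 2 by simp
qed

lemma bform_inject: "bform q A = bform q B \<longleftrightarrow> A = (B :: 'a^'n^'n)"
  by (metis (no_types, lifting) bform_axis(3) vec_eq_iff)

lemma proj_equiv_frob_poly:
  fixes A B :: "'a^'n^'n"
  shows "proj_equiv (frob_poly q A) (frob_poly q B) \<longleftrightarrow>
    (\<exists>g. invertible g \<and> (\<forall>x y. bform q B x y = bform q A (g *v x) (g *v y)))"
proof -
  have "frob_poly q B = lin_change g (frob_poly q A) \<longleftrightarrow> (\<forall>x y. bform q B x y = bform q A (g *v x) (g *v y))" for g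
    unfolding lin_change_frob_poly frob_poly_inject[OF q_ge_2] bform_inject[symmetric]
    by (simp add: fun_eq_iff bform_congr)
  then show ?thesis by (simp add: proj_equiv_def)
qed

end

section \<open>Congruence invariants and the embedding dimension\<close>

text \<open>
The radicals of a form on the whole space, as functions of the bare form, so that they can be compared for
different forms.
\<close>

definition right_null :: "('a::field^'n \<Rightarrow> 'a^'n \<Rightarrow> 'a) \<Rightarrow> ('a^'n) set" where
  "right_null \<beta> = {y. \<forall>x. \<beta> x y = 0}"

definition left_null :: "('a::field^'n \<Rightarrow> 'a^'n \<Rightarrow> 'a) \<Rightarrow> ('a^'n) set" where
  "left_null \<beta> = {x. \<forall>y. \<beta> x y = 0}"

definition right_null_perp :: "('a::field^'n \<Rightarrow> 'a^'n \<Rightarrow> 'a) \<Rightarrow> ('a^'n) set" where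
  "right_null_perp \<beta> = {y. \<forall>r\<in>right_null \<beta>. \<beta> r y = 0}"

definition left_null_perp :: "('a::field^'n \<Rightarrow> 'a^'n \<Rightarrow> 'a) \<Rightarrow> ('a^'n) set" where
  "left_null_perp \<beta> = {x. \<forall>l\<in>left_null \<beta>. \<beta> x l = 0}"

definition radicals_separated :: "('a::field^'n \<Rightarrow> 'a^'n \<Rightarrow> 'a) \<Rightarrow> bool" where
  "radicals_separated \<beta> \<longleftrightarrow> (\<forall>r\<in>right_null \<beta>. (\<forall>l\<in>left_null \<beta>. \<beta> r l = 0) \<longrightarrow> r = 0)"

text \<open>
The values follow the order of the representatives. The first two tests read off the corank (\<open>0\<close>, \<open>1\<close>, \<open>2\<close>). The
pairing of the radicals is nondegenerate exactly when all chains are of type \<open>J_2\<close>. For a single longer chain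
next to \<open>F_m\<close>, the two hyperplanes orthogonal to the radicals coincide for \<open>J_3\<close>, and on their intersection the
form is nonzero for \<open>J_4\<close> (it contains \<open>F_1\<close>) and zero for \<open>J_5\<close>.
\<close>

definition class_index :: "('a::field^'n \<Rightarrow> 'a^'n \<Rightarrow> 'a) \<Rightarrow> nat" where
  "class_index \<beta> =
    (let core = right_null_perp \<beta> \<inter> left_null_perp \<beta>
     in if right_null \<beta> = {0} then 0
        else if \<exists>r. right_null \<beta> \<subseteq> range (\<lambda>c. c *s r)
        then if radicals_separated \<beta> then 1
          else if right_null_perp \<beta> = left_null_perp \<beta> then 4
          else if \<forall>y\<in>core. \<forall>z\<in>core. \<beta> y z = 0 then 3 else 2
        else if radicals_separated \<beta> then 5 else 6)"

lemma class_index_congruent: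
  fixes g :: "'a::field^'n^'n"
  assumes "invertible g"
  shows "class_index (\<lambda>x y. \<beta> (g *v x) (g *v y)) = class_index \<beta>"
proof -
  let ?f = "(*v) g" and ?\<beta>' = "\<lambda>x y. \<beta> (g *v x) (g *v y)"
  obtain g' where g': "g ** g' = mat 1" "g' ** g = mat 1" using assms by (auto simp: invertible_def)
  have f': "g *v (g' *v x) = x" "g' *v (g *v x) = x" for x
    by (simp_all add: matrix_vector_mul_assoc g')
  have surj: "surj ?f" using f' by (metis surjI)
  have inj: "g *v x = g *v y \<longleftrightarrow> x = y" for x y using f' by metis
  have f0: "g *v x = 0 \<longleftrightarrow> x = 0" for x using inj[of x 0] by simp
  have all: "(\<forall>x. P (g *v x)) \<longleftrightarrow> (\<forall>x. P x)" for P using f' by metis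
  have R: "right_null ?\<beta>' = ?f -` right_null \<beta>" and L: "left_null ?\<beta>' = ?f -` left_null \<beta>"
    using all[of "\<lambda>x. \<beta> x y = 0" for y] all[of "\<lambda>y. \<beta> x y = 0" for x]
    by (auto simp: right_null_def left_null_def)
  have ball: "(\<forall>x\<in>?f -` S. P (g *v x)) \<longleftrightarrow> (\<forall>x\<in>S. P x)" for S P
    using all[of "\<lambda>x. x \<in> S \<longrightarrow> P x"] by (auto simp: Ball_def)
  have RP: "right_null_perp ?\<beta>' = ?f -` right_null_perp \<beta>"
    unfolding right_null_perp_def R using ball[of "right_null \<beta>" "\<lambda>r. \<beta> r y = 0" for y] by auto
  have LP: "left_null_perp ?\<beta>' = ?f -` left_null_perp \<beta>"
    unfolding left_null_perp_def L using ball[of "left_null \<beta>" "\<lambda>l. \<beta> x l = 0" for x] by auto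
  have eq: "?f -` S = ?f -` T \<longleftrightarrow> S = T" for S T
    using surj by (metis surj_image_vimage_eq)
  have zero: "?f -` {0} = {0}" using f0 by auto
  have P1: "right_null ?\<beta>' = {0} \<longleftrightarrow> right_null \<beta> = {0}"
    unfolding R using eq[of _ "{0}"] unfolding zero .
  have line: "?f -` range (\<lambda>c. c *s (g *v r)) = range (\<lambda>c. c *s r)" for r
    by (auto simp: vec.scale[symmetric] inj image_iff)
  have sub: "?f -` S \<subseteq> ?f -` T \<longleftrightarrow> S \<subseteq> T" for S T
    using ball[of S "\<lambda>x. x \<in> T"] by auto
  have P2: "(\<exists>r. right_null ?\<beta>' \<subseteq> range (\<lambda>c. c *s r)) \<longleftrightarrow> (\<exists>r. right_null \<beta> \<subseteq> range (\<lambda>c. c *s r))"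
    unfolding R by (subst line[symmetric]) (metis sub f'(1))
  have P3: "radicals_separated ?\<beta>' \<longleftrightarrow> radicals_separated \<beta>"
  proof -
    have "(\<forall>r\<in>right_null ?\<beta>'. (\<forall>l\<in>left_null ?\<beta>'. ?\<beta>' r l = 0) \<longrightarrow> r = 0) \<longleftrightarrow>
        (\<forall>r\<in>?f -` right_null \<beta>. (\<forall>l\<in>left_null \<beta>. \<beta> (g *v r) l = 0) \<longrightarrow> g *v r = 0)"
      unfolding R L f0 using ball[of "left_null \<beta>" "\<lambda>l. \<beta> (g *v r) l = 0" for r] by simp
    then show ?thesis unfolding radicals_separated_def using ball[of "right_null \<beta>" "\<lambda>r. (\<forall>l\<in>left_null \<beta>. \<beta> r l = 0) \<longrightarrow> r = 0"] by simp
  qed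
  have P4: "right_null_perp ?\<beta>' = left_null_perp ?\<beta>' \<longleftrightarrow> right_null_perp \<beta> = left_null_perp \<beta>"
    unfolding RP LP by (rule eq)
  let ?core = "\<lambda>\<beta>. right_null_perp \<beta> \<inter> left_null_perp \<beta>"
  have P5: "(\<forall>y\<in>?core ?\<beta>'. \<forall>z\<in>?core ?\<beta>'. ?\<beta>' y z = 0) \<longleftrightarrow> (\<forall>y\<in>?core \<beta>. \<forall>z\<in>?core \<beta>. \<beta> y z = 0)"
    unfolding RP LP vimage_Int[symmetric]
    using ball[of "?core \<beta>" "\<lambda>z. \<beta> (g *v y) z = 0" for y] ball[of "?core \<beta>" "\<lambda>y. \<forall>z\<in>?core \<beta>. \<beta> y z = 0"] by simp
  show ?thesis
    unfolding class_index_def Let_def P1 P2 P3 P4 P5 ..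
qed

lemma invertible_identity: "invertible (mat 1 :: 'a::field^'n^'n)"
  unfolding invertible_def by (intro exI[of _ "mat 1"]) simp

text \<open>
Replacing the column of the identity matrix at a nonzero coordinate of \<open>v\<close> by \<open>v\<close> gives an invertible matrix.
\<close>

lemma exists_invertible_with_column:
  fixes v :: "'a::field^'n"
  assumes "v \<noteq> 0"
  shows "\<exists>(g :: 'a^'n^'n) k. invertible g \<and> g *v axis k 1 = v"
proof -
  obtain k where k: "v $ k \<noteq> 0" using assms by (auto simp: vec_eq_iff)
  define g :: "'a^'n^'n" where "g = (\<chi> i j. if j = k then v $ i else if i = j then 1 else 0)"
  have gx: "(g *v x) $ i = v $ i * x $ k + (if i = k then 0 else x $ i)" for x i
  proof -
    have "(g *v x) $ i = (\<Sum>j\<in>UNIV. (if j = k then v $ i * x $ k else 0) + (if j = i then (if i = k then 0 else x $ i) else 0))"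
      unfolding matrix_vector_mult_def vec_lambda_beta by (intro sum.cong refl) (auto simp: g_def)
    then show ?thesis by (simp add: sum.distrib)
  qed
  have "x = 0" if "g *v x = 0" for x
  proof -
    have *: "v $ i * x $ k + (if i = k then 0 else x $ i) = 0" for i using that gx[of x i] by simp
    have "x $ k = 0" using *[of k] k by simp
    then show ?thesis using * by (simp add: vec_eq_iff) (metis)
  qed
  then have "\<exists>B. B ** g = mat 1" unfolding matrix_left_invertible_ker by blast
  then have "invertible g" unfolding invertible_left_inverse .
  moreover have "g *v axis k 1 = v" by (simp add: vec_eq_iff gx axis_def)
  ultimately show ?thesis by blast
qed

context frobenius_power
begin

text \<open>
The variable \<open>x_k\<close> is missing after the change of variables \<open>g\<close> exactly when row and column \<open>k\<close> of the new matrix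
vanish, that is, when the \<open>k\<close>-th column of \<open>g\<close> lies in both radicals. Every nonzero vector is a column
of some invertible \<open>g\<close>.
\<close>

lemma full_vars_iff:
  fixes A :: "'a^'n^'n"
  shows "(\<forall>g. invertible g \<longrightarrow> vars (lin_change g (frob_poly q A)) = UNIV) \<longleftrightarrow>
    right_null (bform q A) \<inter> left_null (bform q A) = {0}"
proof -
  interpret B: frobenius_sesquilinear q "bform q A" by (rule frobenius_sesquilinear_bform)
  let ?N = "right_null (bform q A) \<inter> left_null (bform q A)"
  have missing: "k \<notin> vars (lin_change g (frob_poly q A)) \<longleftrightarrow> g *v axis k 1 \<in> ?N" if g: "invertible g" for g k
  proof -
    interpret C: frobenius_sesquilinear q "bform q (congr q g A)" by (rule frobenius_sesquilinear_bform)
    have surj: "\<exists>x. g *v x = y" for y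
      using g by (metis invertible_def matrix_vector_mul_assoc matrix_vector_mul_lid)
    have "k \<notin> vars (lin_change g (frob_poly q A)) \<longleftrightarrow>
      (\<forall>i. bform q (congr q g A) (axis i 1) (axis k 1) = 0) \<and> (\<forall>i. bform q (congr q g A) (axis k 1) (axis i 1) = 0)"
      by (auto simp: lin_change_frob_poly vars_frob_poly[OF q_ge_2] bform_axis(3))
    also have "\<dots> \<longleftrightarrow> (\<forall>x. bform q (congr q g A) x (axis k 1) = 0) \<and> (\<forall>x. bform q (congr q g A) (axis k 1) x = 0)"
    proof -
      have sp: "x \<in> vec.span cart_basis" for x :: "'a^'n" by simp
      have "bform q (congr q g A) x (axis k 1) = 0" if "\<forall>i. bform q (congr q g A) (axis i 1) (axis k 1) = 0" for x
        by (rule C.left_zero_on_span[OF _ sp]) (use that in \<open>auto simp: cart_basis_def\<close>)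
      moreover have "bform q (congr q g A) (axis k 1) x = 0" if "\<forall>i. bform q (congr q g A) (axis k 1) (axis i 1) = 0" for x
        by (rule C.right_zero_on_span[OF _ sp]) (use that in \<open>auto simp: cart_basis_def\<close>)
      ultimately show ?thesis by blast
    qed
    also have "\<dots> \<longleftrightarrow> (\<forall>y. bform q A y (g *v axis k 1) = 0) \<and> (\<forall>y. bform q A (g *v axis k 1) y = 0)"
      unfolding bform_congr using surj by metis
    finally show ?thesis by (simp add: right_null_def left_null_def)
  qed
  have ne: "g *v axis k (1::'a) \<noteq> 0" if inv: "invertible g" for g :: "'a^'n^'n" and k
  proof
    assume 0: "g *v axis k 1 = 0"
    obtain g' :: "'a^'n^'n" where "g' ** g = mat 1" using inv unfolding invertible_def by blast
    then have "g' *v (g *v axis k 1) = axis k 1" by (simp add: matrix_vector_mul_assoc)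
    then have "axis k (1::'a) = (0 :: 'a^'n)" using 0 by simp
    then show False by (simp add: axis_eq_0_iff)
  qed
  have 0: "0 \<in> ?N" by (simp add: right_null_def left_null_def)
  show ?thesis
  proof
    assume full: "\<forall>g. invertible g \<longrightarrow> vars (lin_change g (frob_poly q A)) = UNIV"
    have "v = 0" if "v \<in> ?N" for v
    proof (rule ccontr)
      assume "v \<noteq> 0"
      then obtain g :: "'a^'n^'n" and k where "invertible g" "g *v axis k 1 = v" using exists_invertible_with_column by blast
      then show False using missing[of g k] that full by blast
    qed
    then show "?N = {0}" using 0 by blast
  next
    assume "?N = {0}"
    then show "\<forall>g. invertible g \<longrightarrow> vars (lin_change g (frob_poly q A)) = UNIV"
      using missing ne by blast
  qed
qed

lemma embedding_dim_full_iff: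
  fixes A :: "'a^'n^'n"
  shows "embedding_dim (frob_poly q A) = CARD('n) \<longleftrightarrow> right_null (bform q A) \<inter> left_null (bform q A) = {0}"
proof -
  let ?P = "\<lambda>r. \<exists>g :: 'a^'n^'n. invertible g \<and> card (vars (lin_change g (frob_poly q A))) = r"
  have full: "card S = CARD('n) \<longleftrightarrow> S = UNIV" for S :: "'n set"
    using card_subset_eq[of UNIV S] by auto
  have id: "?P (card (vars (lin_change (mat 1) (frob_poly q A))))" using invertible_identity by blast
  have "embedding_dim (frob_poly q A) = CARD('n) \<longleftrightarrow> (\<forall>g :: 'a^'n^'n. invertible g \<longrightarrow> vars (lin_change g (frob_poly q A)) = UNIV)"
  proof
    assume e: "embedding_dim (frob_poly q A) = CARD('n)"
    show "\<forall>g :: 'a^'n^'n. invertible g \<longrightarrow> vars (lin_change g (frob_poly q A)) = UNIV"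
    proof (intro allI impI)
      fix g :: "'a^'n^'n" assume g: "invertible g"
      have "CARD('n) \<le> card (vars (lin_change g (frob_poly q A)))"
        unfolding e[symmetric] embedding_dim_def by (rule Least_le) (use g in blast)
      then show "vars (lin_change g (frob_poly q A)) = UNIV"
        using card_mono[OF finite subset_UNIV, of "vars (lin_change g (frob_poly q A))"] full by (metis le_antisym)
    qed
  next
    assume a: "\<forall>g :: 'a^'n^'n. invertible g \<longrightarrow> vars (lin_change g (frob_poly q A)) = UNIV"
    have eq: "?P r \<longleftrightarrow> r = CARD('n)" for r
    proof
      assume "r = CARD('n)"
      then show "?P r" using a[rule_format, OF invertible_identity] invertible_identity
        by (intro exI[of _ "mat 1"]) simp
    next
      assume "?P r"
      then obtain g :: "'a^'n^'n" where "invertible g" "card (vars (lin_change g (frob_poly q A))) = r" by blast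
      then show "r = CARD('n)" using a[rule_format, of g] by simp
    qed
    show "embedding_dim (frob_poly q A) = CARD('n)"
      unfolding embedding_dim_def eq by (rule Least_equality) simp_all
  qed
  then show ?thesis unfolding full_vars_iff .
qed

end

section \<open>The seven representatives\<close>

lemma exhaust_5: "x = 1 \<or> x = 2 \<or> x = 3 \<or> x = 4 \<or> x = 5" for x :: 5
proof (induct x)
  case (of_int z)
  then have "z = 0 \<or> z = 1 \<or> z = 2 \<or> z = 3 \<or> z = 4" by fastforce
  then show ?case by auto
qed

lemma forall_5: "(\<forall>i::5. P i) \<longleftrightarrow> P 1 \<and> P 2 \<and> P 3 \<and> P 4 \<and> P 5"
  by (metis exhaust_5)

lemma UNIV_5: "UNIV = {1, 2, 3, 4, 5 :: 5}"
  using exhaust_5 by auto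

lemma sum_5: "sum f (UNIV :: 5 set) = f 1 + f 2 + f 3 + f 4 + f 5"
  unfolding UNIV_5 by (simp add: ac_simps)

text \<open>
The index type of order five has \<open>5 = 0\<close>; vertices of graphs are natural numbers, where \<open>5\<close> keeps its name.
\<close>

definition label :: "5 \<Rightarrow> nat" where
  "label k = (if k = 1 then 1 else if k = 2 then 2 else if k = 3 then 3 else if k = 4 then 4 else 5)"

lemma label_simps [simp]: "label 1 = 1" "label 2 = 2" "label 3 = 3" "label 4 = 4" "label 5 = 5"
  by (simp_all add: label_def)

definition graph_matrix :: "(nat \<times> nat) set \<Rightarrow> 'a::zero_neq_one^5^5" where
  "graph_matrix E = (\<chi> i j. of_bool ((label i, label j) \<in> E))"

lemma quinary_representatives_eq:
  "quinary_representatives q = map (\<lambda>E. frob_poly q (graph_matrix E)) quinary_graphs"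
  by (simp add: quinary_representatives_def quinary_graphs_def graph_defs frob_poly_def graph_matrix_def sum_5 mult.commute)

lemma mult_axis: "g *v axis k 1 = column k g" for g :: "'a::field^'n^'m"
  by (simp add: vec_eq_iff matrix_vector_mult_def column_def axis_def if_distrib[of "\<lambda>x. _ * x"] cong: if_cong)

context frobenius_power
begin

text \<open>
The vectors of an adapted basis are the columns of the required change of variables.
\<close>

lemma adapted_imp_proj_equiv:
  fixes A :: "'a^5^5"
  assumes "sesquilinear.adapted (bform q A) E"
  shows "proj_equiv (frob_poly q A) (frob_poly q (graph_matrix E))"
proof -
  interpret B: frobenius_sesquilinear q "bform q A" by (rule frobenius_sesquilinear_bform)
  obtain vs where span: "vec.span (set vs) = UNIV" and gram: "B.gram vs = pattern E"
    using assms by (auto simp: B.adapted_def)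
  have "length vs = 5" using arg_cong[OF gram, of length] by (simp add: B.gram_def pattern_def)
  then obtain a b c d e where vs: "vs = [a, b, c, d, e]" by (auto simp: length_Suc_conv numeral_eq_Suc)
  define g :: "'a^5^5" where "g = (\<chi> i j. ([a, b, c, d, e] ! (label j - 1)) $ i)"
  have col: "g *v axis 1 1 = a" "g *v axis 2 1 = b" "g *v axis 3 1 = c" "g *v axis 4 1 = d" "g *v axis 5 1 = e"
    by (simp_all add: mult_axis column_def g_def)
  have "columns g = (\<lambda>i. g *v axis i 1) ` UNIV"
    unfolding columns_def mult_axis[symmetric] by blast
  then have "columns g = {a, b, c, d, e}" by (simp add: UNIV_5 col)
  then have "\<exists>B. g ** B = mat 1"
    using span by (simp add: matrix_right_invertible_span_columns vs)
  then have inv: "invertible g" unfolding invertible_right_inverse .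
  have "congr q g A $ i $ j = graph_matrix E $ i $ j" for i j
  proof -
    have "congr q g A $ i $ j = bform q A (g *v axis i 1) (g *v axis j 1)"
      unfolding bform_congr[symmetric] bform_axis(3) ..
    then show ?thesis
      using gram exhaust_5[of i] exhaust_5[of j]
      by (elim disjE) (simp_all add: vs B.gram_def pattern_def col graph_matrix_def)
  qed
  then have "congr q g A = graph_matrix E" by (simp add: vec_eq_iff)
  then have "frob_poly q (graph_matrix E) = lin_change g (frob_poly q A)"
    by (simp add: lin_change_frob_poly)
  then show ?thesis using inv by (auto simp: proj_equiv_def)
qed

lemma null_sets:
  fixes A :: "'a^'n^'n"
  shows "right_null (bform q A) = {y. \<forall>i. (\<Sum>j\<in>UNIV. A $ i $ j * y $ j) = 0}"
    and "left_null (bform q A) = {x. \<forall>j. (\<Sum>i\<in>UNIV. x $ i ^ q * A $ i $ j) = 0}"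
proof -
  interpret B: frobenius_sesquilinear q "bform q A" by (rule frobenius_sesquilinear_bform)
  have sp: "x \<in> vec.span cart_basis" for x :: "'a^'n" by simp
  have "bform q A x y = 0" if "\<forall>i. bform q A (axis i 1) y = 0" for x y
    by (rule B.left_zero_on_span[OF _ sp]) (use that in \<open>auto simp: cart_basis_def\<close>)
  then show "right_null (bform q A) = {y. \<forall>i. (\<Sum>j\<in>UNIV. A $ i $ j * y $ j) = 0}"
    unfolding bform_axis(1)[symmetric] right_null_def by blast
  have "bform q A x y = 0" if "\<forall>j. bform q A x (axis j 1) = 0" for x y
    by (rule B.right_zero_on_span[OF _ sp]) (use that in \<open>auto simp: cart_basis_def\<close>)
  then show "left_null (bform q A) = {x. \<forall>j. (\<Sum>i\<in>UNIV. x $ i ^ q * A $ i $ j) = 0}"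
    unfolding bform_axis(2)[symmetric] left_null_def by blast
qed

lemma q_pos [simp]: "q > 0" using q_ge_2 by simp

abbreviation graph_form :: "(nat \<times> nat) set \<Rightarrow> 'a^5 \<Rightarrow> 'a^5 \<Rightarrow> 'a" where
  "graph_form E \<equiv> bform q (graph_matrix E)"

lemma graph_right_null:
  "right_null (graph_form graph_F5) = {y. y $ 1 = 0 \<and> y $ 2 = 0 \<and> y $ 3 = 0 \<and> y $ 4 = 0 \<and> y $ 5 = 0}"
    "right_null (graph_form graph_J2_F3) = {y. y $ 2 = 0 \<and> y $ 3 = 0 \<and> y $ 4 = 0 \<and> y $ 5 = 0}"
    "right_null (graph_form graph_J4_F1) = {y. y $ 1 = 0 \<and> y $ 3 = 0 \<and> y $ 4 = 0 \<and> y $ 5 = 0}"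
    "right_null (graph_form graph_J5) = {y. y $ 1 = 0 \<and> y $ 2 = 0 \<and> y $ 4 = 0 \<and> y $ 5 = 0}"
    "right_null (graph_form graph_J3_F2) = {y. y $ 1 = 0 \<and> y $ 2 = 0 \<and> y $ 3 = 0 \<and> y $ 5 = 0}"
    "right_null (graph_form graph_J2_J2_F1) = {y. y $ 3 = 0 \<and> y $ 4 = 0 \<and> y $ 5 = 0}"
    "right_null (graph_form graph_J3_J2) = {y. y $ 2 = 0 \<and> y $ 4 = 0 \<and> y $ 5 = 0}"
  by (auto simp: null_sets graph_matrix_def graph_defs sum_5 forall_5)

lemma graph_left_null:
  "left_null (graph_form graph_F5) = {x. x $ 1 = 0 \<and> x $ 2 = 0 \<and> x $ 3 = 0 \<and> x $ 4 = 0 \<and> x $ 5 = 0}"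
    "left_null (graph_form graph_J2_F3) = {x. x $ 1 = 0 \<and> x $ 2 = 0 \<and> x $ 3 = 0 \<and> x $ 4 = 0}"
    "left_null (graph_form graph_J4_F1) = {x. x $ 1 = 0 \<and> x $ 2 = 0 \<and> x $ 3 = 0 \<and> x $ 4 = 0}"
    "left_null (graph_form graph_J5) = {x. x $ 1 = 0 \<and> x $ 2 = 0 \<and> x $ 3 = 0 \<and> x $ 4 = 0}"
    "left_null (graph_form graph_J3_F2) = {x. x $ 1 = 0 \<and> x $ 2 = 0 \<and> x $ 3 = 0 \<and> x $ 4 = 0}"
    "left_null (graph_form graph_J2_J2_F1) = {x. x $ 1 = 0 \<and> x $ 2 = 0 \<and> x $ 3 = 0}"
    "left_null (graph_form graph_J3_J2) = {x. x $ 1 = 0 \<and> x $ 2 = 0 \<and> x $ 3 = 0}"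
  by (auto simp: null_sets graph_matrix_def graph_defs sum_5 forall_5)

lemma graph_form_expand:
  "graph_form graph_F5 x y = x $ 1 ^ q * y $ 1 + x $ 2 ^ q * y $ 2 + x $ 3 ^ q * y $ 3 + x $ 4 ^ q * y $ 4 + x $ 5 ^ q * y $ 5"
    "graph_form graph_J2_F3 x y = x $ 1 ^ q * y $ 5 + x $ 2 ^ q * y $ 4 + x $ 3 ^ q * y $ 3 + x $ 4 ^ q * y $ 2"
    "graph_form graph_J4_F1 x y = x $ 1 ^ q * y $ 5 + x $ 2 ^ q * y $ 4 + x $ 3 ^ q * y $ 3 + x $ 4 ^ q * y $ 1"
    "graph_form graph_J5 x y = x $ 1 ^ q * y $ 5 + x $ 2 ^ q * y $ 4 + x $ 3 ^ q * y $ 2 + x $ 4 ^ q * y $ 1"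
    "graph_form graph_J3_F2 x y = x $ 1 ^ q * y $ 5 + x $ 2 ^ q * y $ 3 + x $ 3 ^ q * y $ 2 + x $ 4 ^ q * y $ 1"
    "graph_form graph_J2_J2_F1 x y = x $ 1 ^ q * y $ 5 + x $ 2 ^ q * y $ 4 + x $ 3 ^ q * y $ 3"
    "graph_form graph_J3_J2 x y = x $ 1 ^ q * y $ 5 + x $ 2 ^ q * y $ 4 + x $ 3 ^ q * y $ 2"
  by (simp_all add: bform_def graph_matrix_def graph_defs sum_5)

text \<open>
Every vertex of these graphs has an incoming or an outgoing edge, so no coordinate survives in both radicals.
\<close>

lemma graph_nullfree:
  assumes "E \<in> set quinary_graphs"
  shows "right_null (graph_form E) \<inter> left_null (graph_form E) = {0}"
proof -
  have zero: "x = 0 \<longleftrightarrow> x $ 1 = 0 \<and> x $ 2 = 0 \<and> x $ 3 = 0 \<and> x $ 4 = 0 \<and> x $ 5 = 0" for x :: "'a^5"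
    by (simp add: vec_eq_iff forall_5)
  have "E = graph_F5 \<or> E = graph_J2_F3 \<or> E = graph_J4_F1 \<or> E = graph_J5 \<or> E = graph_J3_F2 \<or> E = graph_J2_J2_F1 \<or> E = graph_J3_J2"
    using assms by (simp only: quinary_graphs_def set_simps insert_iff empty_iff simp_thms)
  then show ?thesis
    by (elim disjE; simp only: graph_right_null graph_left_null; auto simp: zero)
qed

end

section \<open>Ranks and invariants of the representatives\<close>

lemma ex_5: "(\<exists>i::5. P i) \<longleftrightarrow> P 1 \<or> P 2 \<or> P 3 \<or> P 4 \<or> P 5"
  by (metis exhaust_5)

lemma Collect_5: "{j::5. P j} = set (filter P [1, 2, 3, 4, 5])"
  by (simp only: set_filter list.set UNIV_5[symmetric] UNIV_I simp_thms)

lemma label_inject: "label i = label j \<longleftrightarrow> i = j"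
  using exhaust_5[of i] exhaust_5[of j] by (elim disjE) simp_all

text \<open>
The rows of a graph matrix are zero or standard basis vectors, so the rank is the number of distinct targets of
edges.
\<close>

lemma dim_coordinate_rows:
  fixes S :: "('a::field^'n) set"
  assumes "(\<lambda>j. axis j 1) ` T \<subseteq> S" "S \<subseteq> insert 0 ((\<lambda>j. axis j 1) ` T)"
  shows "vec.dim S = card T"
proof -
  let ?B = "(\<lambda>j. axis j 1 :: 'a^'n) ` T"
  have "vec.span S \<subseteq> vec.span ?B"
    using vec.span_mono[OF assms(2)] by simp
  then have "vec.span S = vec.span ?B" using vec.span_mono[OF assms(1)] by blast
  then have "vec.dim S = vec.dim ?B" by (rule vec.span_eq_dim)
  also have "\<dots> = card ?B"
    by (rule vec.dim_eq_card_independent, rule vec.independent_mono[OF independent_cart_basis])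
       (auto simp: cart_basis_def)
  also have "\<dots> = card T" by (rule card_image) (auto simp: inj_on_def axis_eq_axis)
  finally show ?thesis .
qed

lemma rank_graph_matrix:
  assumes E: "\<And>i j k. (i, j) \<in> E \<Longrightarrow> (i, k) \<in> E \<Longrightarrow> j = k"
  shows "rank (graph_matrix E :: 'a::field^5^5) = card {j. \<exists>i. (label i, label j) \<in> E}"
  unfolding row_rank_def_gen
proof (rule dim_coordinate_rows)
  let ?M = "graph_matrix E :: 'a^5^5"
  have row: "row i ?M = axis j 1" if "(label i, label j) \<in> E" for i j
    using that E by (auto simp: row_def graph_matrix_def axis_def vec_eq_iff label_inject[symmetric])
  have row0: "row i ?M = 0" if "\<And>j. (label i, label j) \<notin> E" for i
    using that by (simp add: row_def graph_matrix_def vec_eq_iff)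
  show "(\<lambda>j. axis j 1) ` {j. \<exists>i. (label i, label j) \<in> E} \<subseteq> rows ?M"
  proof safe
    fix i j assume "(label i, label j) \<in> E"
    then show "axis j 1 \<in> rows ?M" unfolding rows_def by (intro CollectI exI[of _ i]) (simp add: row)
  qed
  show "rows ?M \<subseteq> insert 0 ((\<lambda>j. axis j 1) ` {j. \<exists>i. (label i, label j) \<in> E})"
  proof
    fix v assume "v \<in> rows ?M"
    then obtain i where v: "v = row i ?M" by (auto simp: rows_def)
    show "v \<in> insert 0 ((\<lambda>j. axis j 1) ` {j. \<exists>i. (label i, label j) \<in> E})"
    proof (cases "\<exists>j. (label i, label j) \<in> E")
      case True
      then obtain j where "(label i, label j) \<in> E" ..
      then show ?thesis using row v by blast
    next
      case False
      then show ?thesis using row0 v by blast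
    qed
  qed
qed

lemma quinary_ranks:
  "map (\<lambda>E. rank (graph_matrix E :: 'a::field^5^5)) quinary_graphs = [5, 4, 4, 4, 4, 3, 3]"
proof -
  have "rank (graph_matrix E :: 'a^5^5) = card {j :: 5. \<exists>i. (label i, label j) \<in> E}" if "E \<in> set quinary_graphs" for E
    by (rule rank_graph_matrix) (use that in \<open>auto simp: quinary_graphs_def graph_defs\<close>)
  note rank = this[unfolded Collect_5 ex_5]
  have mem: "graph_F5 \<in> set quinary_graphs"
    "graph_J2_F3 \<in> set quinary_graphs"
    "graph_J4_F1 \<in> set quinary_graphs"
    "graph_J5 \<in> set quinary_graphs"
    "graph_J3_F2 \<in> set quinary_graphs"
    "graph_J2_J2_F1 \<in> set quinary_graphs"
    "graph_J3_J2 \<in> set quinary_graphs"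
    by (simp_all add: quinary_graphs_def)
  show ?thesis
    unfolding quinary_graphs_def list.map mem[THEN rank] by (simp add: graph_defs)
qed

text \<open>
This recognises corank two: the radicals of the last two representatives contain two coordinate vectors.
\<close>

lemma not_line:
  fixes S :: "('a::field^'n) set"
  assumes "axis i 1 \<in> S" "axis j 1 \<in> S" "i \<noteq> j"
  shows "\<not> (\<exists>r. S \<subseteq> range (\<lambda>c. c *s r))"
proof
  assume "\<exists>r. S \<subseteq> range (\<lambda>c. c *s r)"
  then obtain r c d where c: "axis i (1 :: 'a) = c *s r" and d: "axis j (1 :: 'a) = d *s r"
    using assms(1,2) by blast
  have "c * r $ i = 1" "c * r $ j = 0" "d * r $ j = 1"
    using arg_cong[OF c, of "\<lambda>v. v $ i"] arg_cong[OF c, of "\<lambda>v. v $ j"] arg_cong[OF d, of "\<lambda>v. v $ j"] assms(3)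
    by (simp_all add: axis_def)
  then show False by auto
qed

context frobenius_power
begin

lemma vec5_eq_0_iff: "x = 0 \<longleftrightarrow> x $ 1 = 0 \<and> x $ 2 = 0 \<and> x $ 3 = 0 \<and> x $ 4 = 0 \<and> x $ 5 = 0" for x :: "'a^5"
  by (simp add: vec_eq_iff forall_5)

lemma zero_power_q [simp]: "(0 :: 'a) ^ q = 0"
  by (simp add: power_0_left)

lemma axis_component: "axis i (1::'a) $ j = (if i = j then 1 else 0)"
  by (simp add: axis_def)

text \<open>
The right radical is spanned by the coordinate vectors of the vertices without incoming edge, the left radical by
those of the vertices without outgoing edge, and every test is decided on these vectors.
\<close>

lemma class_index_graph:
  "class_index (graph_form graph_F5) = 0"
  "class_index (graph_form graph_J2_F3) = 1"
  "class_index (graph_form graph_J4_F1) = 2"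
  "class_index (graph_form graph_J5) = 3"
  "class_index (graph_form graph_J3_F2) = 4"
  "class_index (graph_form graph_J2_J2_F1) = 5"
  "class_index (graph_form graph_J3_J2) = 6"
proof -
  note null = graph_right_null graph_left_null axis_component
  note graph = null graph_form_expand
  have degenerate: "right_null \<beta> \<noteq> {0}" if "axis k 1 \<in> right_null \<beta>" for \<beta> :: "'a^5 \<Rightarrow> 'a^5 \<Rightarrow> 'a" and k
  proof
    assume "right_null \<beta> = {0}"
    with that have "axis k (1::'a) = (0 :: 'a^5)" by blast
    then show False by (simp add: axis_eq_0_iff)
  qed
  have line: "\<exists>r. S \<subseteq> range (\<lambda>c. c *s r)" if "\<And>y k. y \<in> S \<Longrightarrow> k \<noteq> i \<Longrightarrow> y $ k = 0" for S :: "('a^5) set" and i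
  proof (intro exI subsetI)
    fix y assume "y \<in> S"
    then have "y = y $ i *s axis i 1" using that by (auto simp: vec_eq_iff axis_component)
    then show "y \<in> range (\<lambda>c. c *s axis i 1)" by blast
  qed
  have not_separated: "\<not> radicals_separated \<beta>"
    if "axis k 1 \<in> right_null \<beta>" "\<forall>l\<in>left_null \<beta>. \<beta> (axis k 1) l = 0" for \<beta> :: "'a^5 \<Rightarrow> 'a^5 \<Rightarrow> 'a" and k
  proof
    assume "radicals_separated \<beta>"
    with that have "axis k (1::'a) = (0 :: 'a^5)" unfolding radicals_separated_def by blast
    then show False by (simp add: axis_eq_0_iff)
  qed
  have right_perp: "right_null_perp \<beta> = {y. y $ j = 0}"
    if "axis k 1 \<in> right_null \<beta>" "\<And>y. \<beta> (axis k 1) y = y $ j" "\<And>r y. r \<in> right_null \<beta> \<Longrightarrow> y $ j = 0 \<Longrightarrow> \<beta> r y = 0"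
    for \<beta> :: "'a^5 \<Rightarrow> 'a^5 \<Rightarrow> 'a" and j k
    unfolding right_null_perp_def using that by fastforce
  have left_perp: "left_null_perp \<beta> = {x. x $ 1 = 0}"
    if "axis 5 1 \<in> left_null \<beta>" "\<And>x. \<beta> x (axis 5 1) = x $ 1 ^ q" "\<And>l x. l \<in> left_null \<beta> \<Longrightarrow> x $ 1 = 0 \<Longrightarrow> \<beta> x l = 0"
    for \<beta> :: "'a^5 \<Rightarrow> 'a^5 \<Rightarrow> 'a"
    unfolding left_null_perp_def using that by fastforce
  have perps_differ: "{y :: 'a^5. y $ i = 0} \<noteq> {x. x $ 1 = 0}" if "i \<noteq> 1" for i
  proof
    assume "{y :: 'a^5. y $ i = 0} = {x. x $ 1 = 0}"
    moreover have "axis 1 1 \<in> {y :: 'a^5. y $ i = 0}" using that by (simp add: axis_component)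
    ultimately show False by (simp add: axis_component)
  qed

  have "right_null (graph_form graph_F5) = {0}" by (auto simp: null vec5_eq_0_iff)
  then show "class_index (graph_form graph_F5) = 0" by (simp only: class_index_def Let_def if_True simp_thms)

  let ?b = "graph_form graph_J2_F3"
  have "right_null ?b \<noteq> {0}"
    by (rule degenerate[of 1]) (simp add: null)
  moreover have "\<exists>r. right_null ?b \<subseteq> range (\<lambda>c. c *s r)"
    by (rule line[of _ 1]) (use exhaust_5 in \<open>force simp: null\<close>)
  moreover have "radicals_separated ?b"
    unfolding radicals_separated_def
  proof (intro ballI impI)
    fix r assume r: "r \<in> right_null ?b" and orth: "\<forall>l\<in>left_null ?b. ?b r l = 0"
    have "?b r (axis 5 1) = 0"
      using orth by (simp_all add: null)
    then show "r = 0" using r by (simp add: vec5_eq_0_iff graph)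
  qed
  ultimately show "class_index ?b = 1"
    unfolding class_index_def Let_def by simp

  let ?b = "graph_form graph_J4_F1"
  have "right_null ?b \<noteq> {0}"
    by (rule degenerate[of 2]) (simp add: null)
  moreover have "\<exists>r. right_null ?b \<subseteq> range (\<lambda>c. c *s r)"
    by (rule line[of _ 2]) (use exhaust_5 in \<open>force simp: null\<close>)
  moreover have "\<not> radicals_separated ?b"
    by (rule not_separated[of 2]) (simp_all add: graph)
  moreover have "right_null_perp ?b = {y. y $ 4 = 0}"
    by (rule right_perp[of 2]) (simp_all add: graph)
  moreover have "left_null_perp ?b = {x. x $ 1 = 0}"
    by (rule left_perp) (simp_all add: graph)
  moreover have "\<not> (\<forall>y\<in>{y. y $ 4 = 0} \<inter> {x. x $ 1 = 0}. \<forall>z\<in>{y. y $ 4 = 0} \<inter> {x. x $ 1 = 0}. ?b y z = 0)"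
  proof
    assume a: "\<forall>y\<in>{y. y $ 4 = 0} \<inter> {x. x $ 1 = 0}. \<forall>z\<in>{y. y $ 4 = 0} \<inter> {x. x $ 1 = 0}. ?b y z = 0"
    have "axis 3 1 \<in> {y :: 'a^5. y $ 4 = 0} \<inter> {x. x $ 1 = 0}" by (simp add: axis_component)
    with a have "?b (axis 3 1) (axis 3 1) = 0" by blast
    then show False by (simp add: graph)
  qed
  ultimately show "class_index ?b = 2"
    unfolding class_index_def Let_def using perps_differ by simp

  let ?b = "graph_form graph_J5"
  have "right_null ?b \<noteq> {0}"
    by (rule degenerate[of 3]) (simp add: null)
  moreover have "\<exists>r. right_null ?b \<subseteq> range (\<lambda>c. c *s r)"
    by (rule line[of _ 3]) (use exhaust_5 in \<open>force simp: null\<close>)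
  moreover have "\<not> radicals_separated ?b"
    by (rule not_separated[of 3]) (simp_all add: graph)
  moreover have "right_null_perp ?b = {y. y $ 2 = 0}"
    by (rule right_perp[of 3]) (simp_all add: graph)
  moreover have "left_null_perp ?b = {x. x $ 1 = 0}"
    by (rule left_perp) (simp_all add: graph)
  moreover have "\<forall>y\<in>{y. y $ 2 = 0} \<inter> {x. x $ 1 = 0}. \<forall>z\<in>{y. y $ 2 = 0} \<inter> {x. x $ 1 = 0}. ?b y z = 0"
    by (simp add: graph)
  ultimately show "class_index ?b = 3"
    unfolding class_index_def Let_def using perps_differ by simp

  let ?b = "graph_form graph_J3_F2"
  have "right_null ?b \<noteq> {0}"
    by (rule degenerate[of 4]) (simp add: null)
  moreover have "\<exists>r. right_null ?b \<subseteq> range (\<lambda>c. c *s r)"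
    by (rule line[of _ 4]) (use exhaust_5 in \<open>force simp: null\<close>)
  moreover have "\<not> radicals_separated ?b"
    by (rule not_separated[of 4]) (simp_all add: graph)
  moreover have "right_null_perp ?b = {y. y $ 1 = 0}"
    by (rule right_perp[of 4]) (simp_all add: graph)
  moreover have "left_null_perp ?b = {x. x $ 1 = 0}"
    by (rule left_perp) (simp_all add: graph)
  ultimately show "class_index ?b = 4"
    unfolding class_index_def Let_def by simp

  let ?b = "graph_form graph_J2_J2_F1"
  have "right_null ?b \<noteq> {0}"
    by (rule degenerate[of 1]) (simp add: null)
  moreover have "\<not> (\<exists>r. right_null ?b \<subseteq> range (\<lambda>c. c *s r))"
    by (rule not_line[of 1 _ 2]) (simp_all add: null)
  moreover have "radicals_separated ?b"
    unfolding radicals_separated_def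
  proof (intro ballI impI)
    fix r assume r: "r \<in> right_null ?b" and orth: "\<forall>l\<in>left_null ?b. ?b r l = 0"
    have "?b r (axis 5 1) = 0" "?b r (axis 4 1) = 0"
      using orth by (simp_all add: null)
    then show "r = 0" using r by (simp add: vec5_eq_0_iff graph)
  qed
  ultimately show "class_index ?b = 5"
    unfolding class_index_def Let_def by simp

  let ?b = "graph_form graph_J3_J2"
  have "right_null ?b \<noteq> {0}"
    by (rule degenerate[of 1]) (simp add: null)
  moreover have "\<not> (\<exists>r. right_null ?b \<subseteq> range (\<lambda>c. c *s r))"
    by (rule not_line[of 1 _ 3]) (simp_all add: null)
  moreover have "\<not> radicals_separated ?b"
    by (rule not_separated[of 3]) (simp_all add: graph)
  ultimately show "class_index ?b = 6"
    unfolding class_index_def Let_def by simp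
qed

end

section \<open>The classification\<close>

context frobenius_power
begin

lemma quinary_frobenius_forms_iff:
  "(h :: (5, 'a) mpoly) \<in> quinary_frobenius_forms q \<longleftrightarrow>
    (\<exists>A. h = frob_poly q A \<and> right_null (bform q A) \<inter> left_null (bform q A) = {0})"
  using embedding_dim_full_iff[where ?'n = 5]
  by (auto simp: quinary_frobenius_forms_def frobenius_form_iff)

lemma class_index_representative:
  assumes "i < 7"
  shows "class_index (graph_form (quinary_graphs ! i)) = i"
proof -
  have "i = 0 \<or> i = 1 \<or> i = 2 \<or> i = 3 \<or> i = 4 \<or> i = 5 \<or> i = 6" using assms by linarith
  then show ?thesis by (elim disjE) (simp_all add: quinary_graphs_def class_index_graph)
qed

lemma class_index_proj_equiv:
  fixes A B :: "'a^'n^'n"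
  assumes "proj_equiv (frob_poly q A) (frob_poly q B)"
  shows "class_index (bform q A) = class_index (bform q B)"
proof -
  obtain g :: "'a^'n^'n" where g: "invertible g" "\<And>x y. bform q B x y = bform q A (g *v x) (g *v y)"
    using assms by (auto simp: proj_equiv_frob_poly)
  have "bform q B = (\<lambda>x y. bform q A (g *v x) (g *v y))" using g(2) by blast
  then show ?thesis using class_index_congruent[OF g(1), of "bform q A"] by simp
qed

lemma ex_representative:
  assumes "(h :: (5, 'a) mpoly) \<in> quinary_frobenius_forms q"
  shows "\<exists>E \<in> set quinary_graphs. proj_equiv h (frob_poly q (graph_matrix E))"
proof -
  obtain A where A: "h = frob_poly q A" "right_null (bform q A) \<inter> left_null (bform q A) = {0}"
    using assms by (auto simp: quinary_frobenius_forms_iff)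
  interpret B: frobenius_sesquilinear q "bform q A" by (rule frobenius_sesquilinear_bform)
  have "B.right_radical UNIV \<inter> B.left_radical UNIV = {0}"
    using A(2) by (simp add: B.right_radical_def B.left_radical_def right_null_def left_null_def)
  moreover have "vec.dim (UNIV :: ('a^5) set) = 5" by (simp add: card_cart_basis)
  ultimately show ?thesis using B.normal_form adapted_imp_proj_equiv unfolding A(1) by blast
qed

lemma proj_equiv_refl: "proj_equiv (frob_poly q A) (frob_poly q (A :: 'a^'n^'n))"
  unfolding proj_equiv_frob_poly by (intro exI[of _ "mat 1"]) (simp add: invertible_identity)

lemma proj_equiv_sym:
  fixes A B :: "'a^'n^'n"
  assumes "proj_equiv (frob_poly q A) (frob_poly q B)"
  shows "proj_equiv (frob_poly q B) (frob_poly q A)"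
proof -
  obtain g :: "'a^'n^'n" where g: "invertible g" "\<And>x y. bform q B x y = bform q A (g *v x) (g *v y)"
    using assms by (auto simp: proj_equiv_frob_poly)
  obtain g' where g': "g ** g' = mat 1" "g' ** g = mat 1" using g(1) unfolding invertible_def by blast
  have "bform q A x y = bform q B (g' *v x) (g' *v y)" for x y
    by (simp add: g(2) matrix_vector_mul_assoc g')
  moreover have "invertible g'" using g' unfolding invertible_def by blast
  ultimately show ?thesis unfolding proj_equiv_frob_poly by blast
qed

lemma proj_equiv_trans:
  fixes A B C :: "'a^'n^'n"
  assumes "proj_equiv (frob_poly q A) (frob_poly q B)" "proj_equiv (frob_poly q B) (frob_poly q C)"
  shows "proj_equiv (frob_poly q A) (frob_poly q C)"
proof -
  obtain g :: "'a^'n^'n" where g: "invertible g" "\<And>x y. bform q B x y = bform q A (g *v x) (g *v y)"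
    using assms(1) by (auto simp: proj_equiv_frob_poly)
  obtain k :: "'a^'n^'n" where k: "invertible k" "\<And>x y. bform q C x y = bform q B (k *v x) (k *v y)"
    using assms(2) by (auto simp: proj_equiv_frob_poly)
  have "bform q C x y = bform q A ((g ** k) *v x) ((g ** k) *v y)" for x y
    by (simp add: g(2) k(2) matrix_vector_mul_assoc)
  then show ?thesis unfolding proj_equiv_frob_poly using invertible_mult[OF g(1) k(1)] by blast
qed

lemma equiv_quinary_equiv: "equiv (quinary_frobenius_forms q :: (5, 'a) mpoly set) (quinary_equiv q)"
proof (rule equivI)
  let ?r = "quinary_equiv q :: ((5, 'a) mpoly \<times> (5, 'a) mpoly) set"
  show "?r \<subseteq> quinary_frobenius_forms q \<times> quinary_frobenius_forms q"
    by (auto simp: quinary_equiv_def)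
  have form: "\<exists>A. h = frob_poly q A" if "h \<in> quinary_frobenius_forms q" for h :: "(5, 'a) mpoly"
    using that by (auto simp: quinary_frobenius_forms_iff)
  have r: "(h, h') \<in> ?r \<longleftrightarrow> h \<in> quinary_frobenius_forms q \<and> h' \<in> quinary_frobenius_forms q \<and> proj_equiv h h'" for h h'
    by (simp add: quinary_equiv_def)
  show "refl_on (quinary_frobenius_forms q) ?r"
    unfolding refl_on_def r using form proj_equiv_refl by metis
  show "sym ?r"
    unfolding sym_def r using form proj_equiv_sym by metis
  show "trans ?r"
    unfolding trans_def r using form proj_equiv_trans by metis
qed

abbreviation representative :: "nat \<Rightarrow> (5, 'a) mpoly" where
  "representative i \<equiv> quinary_representatives q ! i"

lemma length_quinary_graphs: "length quinary_graphs = 7"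
  by (simp add: quinary_graphs_def)

lemma representative_eq: "i < 7 \<Longrightarrow> representative i = frob_poly q (graph_matrix (quinary_graphs ! i))"
  by (simp add: quinary_representatives_eq length_quinary_graphs)

lemma representatives_mem: "set (quinary_representatives q) \<subseteq> (quinary_frobenius_forms q :: (5, 'a) mpoly set)"
proof
  fix h :: "(5, 'a) mpoly" assume "h \<in> set (quinary_representatives q)"
  then obtain E where "E \<in> set quinary_graphs" "h = frob_poly q (graph_matrix E)"
    by (auto simp: quinary_representatives_eq)
  then show "h \<in> quinary_frobenius_forms q"
    using graph_nullfree unfolding quinary_frobenius_forms_iff by blast
qed

lemma representative_mem: "i < 7 \<Longrightarrow> representative i \<in> quinary_frobenius_forms q"
  using representatives_mem by (metis (no_types, lifting) length_map length_quinary_graphs nth_mem quinary_representatives_eq subsetD)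

text \<open>
Existence is the normal form. The index is determined because \<open>class_index\<close> is preserved by equivalence and
equals \<open>i\<close> on the \<open>i\<close>-th representative.
\<close>

lemma unique_representative:
  assumes h: "(h :: (5, 'a) mpoly) \<in> quinary_frobenius_forms q"
  shows "\<exists>!i. i < 7 \<and> proj_equiv h (representative i)"
proof -
  obtain A where A: "h = frob_poly q A" using h by (auto simp: quinary_frobenius_forms_iff)
  obtain E where E: "E \<in> set quinary_graphs" "proj_equiv h (frob_poly q (graph_matrix E))"
    using ex_representative[OF h] by blast
  then obtain i where i: "i < 7" "quinary_graphs ! i = E"
    by (metis in_set_conv_nth length_quinary_graphs)
  have "j = class_index (bform q A)" if "j < 7" "proj_equiv h (representative j)" for j
    using that class_index_proj_equiv[of A "graph_matrix (quinary_graphs ! j)"] class_index_representative[of j]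
    by (simp add: A representative_eq)
  then show ?thesis using E i representative_eq[of i] by metis
qed

lemma card_quotient:
  "card ((quinary_frobenius_forms q :: (5, 'a) mpoly set) // quinary_equiv q) = 7"
proof -
  let ?F = "quinary_frobenius_forms q :: (5, 'a) mpoly set" and ?r = "quinary_equiv q :: ((5, 'a) mpoly \<times> _) set"
  let ?cls = "\<lambda>i. ?r `` {representative i}"
  have "?F // ?r = ?cls ` {..<7}"
  proof
    show "?F // ?r \<subseteq> ?cls ` {..<7}"
    proof
      fix X assume "X \<in> ?F // ?r"
      then obtain h where h: "X = ?r `` {h}" "h \<in> ?F" by (rule quotientE)
      then obtain i where i: "i < 7" "proj_equiv h (representative i)" using unique_representative by blast
      then have "(h, representative i) \<in> ?r"
        using h representative_mem by (simp add: quinary_equiv_def)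
      then have "X = ?cls i" using equiv_class_eq[OF equiv_quinary_equiv] h by blast
      then show "X \<in> ?cls ` {..<7}" using i by blast
    qed
    show "?cls ` {..<7} \<subseteq> ?F // ?r" using representative_mem by (auto intro: quotientI)
  qed
  moreover have "inj_on ?cls {..<7}"
  proof (rule inj_onI)
    fix i j :: nat assume ij: "i \<in> {..<7}" "j \<in> {..<7}" "?cls i = ?cls j"
    then have i: "i < 7" and j: "j < 7" by simp_all
    have "(representative i, representative j) \<in> ?r"
      using eq_equiv_class[OF ij(3) equiv_quinary_equiv] representative_mem[OF j] by blast
    then have "proj_equiv (representative i) (representative j)" by (simp add: quinary_equiv_def)
    moreover have "proj_equiv (representative i) (representative i)"
      by (simp add: representative_eq[OF i] proj_equiv_refl)
    ultimately show "i = j" using unique_representative[OF representative_mem[OF i]] i j by blast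
  qed
  ultimately show ?thesis by (simp add: card_image)
qed

lemma representative_ranks:
  "map (frobenius_rank q) (quinary_representatives q :: (5, 'a) mpoly list) = [5, 4, 4, 4, 4, 3, 3]"
  unfolding quinary_representatives_eq quinary_ranks[symmetric, where ?'a = 'a]
  by (simp add: frobenius_rank_def frobenius_matrix_frob_poly[OF q_ge_2])

end

theorem theorem4p0p1:
  fixes p e q :: nat
  assumes "CHAR('a :: alg_closed_field) = p" and "p > 0" and "e \<ge> 1" and "q = p ^ e"
  shows "equiv (quinary_frobenius_forms q :: (5, 'a) mpoly set) (quinary_equiv q) \<and>
    card ((quinary_frobenius_forms q :: (5, 'a) mpoly set) // quinary_equiv q) = 7 \<and>
    set (quinary_representatives q) \<subseteq> (quinary_frobenius_forms q :: (5, 'a) mpoly set) \<and>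
    map (frobenius_rank q) (quinary_representatives q :: (5, 'a) mpoly list) =
      [5, 4, 4, 4, 4, 3, 3] \<and>
    (\<forall>h \<in> (quinary_frobenius_forms q :: (5, 'a) mpoly set).
       \<exists>!i. i < 7 \<and> proj_equiv h (quinary_representatives q ! i))"
proof -
  interpret frobenius_power q e "TYPE('a)"
    by unfold_locales (use assms prime_CHAR_semidom[where ?'a = 'a] in auto)
  show ?thesis
    using equiv_quinary_equiv card_quotient representatives_mem representative_ranks unique_representative
    by blast
qed

end
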